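(* Let $M=\psi(X)$ be a generic geometric swallowtail, where $X=f(\mathbb{R}^2,0)$ is the standard swallowtail and $\psi:(\mathbb{R}^3,0)\to(\mathbb{R}^3,0)$ is a germ of diffeomorphism. Let $\nu\in S^2$, let $h_\nu(p)=p\cdot\nu$ be the height function, and let $\widehat g$ be the normal form (among those listed in (i)–(iv) below) to which $h_\nu\circ\psi$ is $\mathcal{R}(X)$-equivalent. The possible singularities of $\widehat g\circ f$ have the following geometric interpretations in terms of the plane $h_\nu^{-1}(0)$: \begin{itemize} \item[(i)] $\widehat g=\pm u$: the plane is transverse to the swallowtail $M$, to its singular curve and to its double point curve; \item[(ii)] $\widehat g=v+au^2$ ($a\ne 0$): the plane is transverse to the swallowtail and is in the pencil of planes obtained as limiting tangents to the double point curve (which coincides with that of the singular curve); \item[(iii)] $\widehat g=v+au^3$ ($a\neq 0$): the plane is transverse to the swallowtail, is in the pencil of planes obtained as limiting tangents to the singular curve, and is the limiting osculating plane to the double point curve; \item[(iv)] $\widehat g=\pm w+au^2+bu^3$ ($a\neq 0,\pm\frac1{12},\pm\frac14$, $b\neq 0$): the plane is the tangent cone of the swallowtail. \end{itemize}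
   Context: The standard swallowtail $X$ is the image germ of $f(x,y)=(x,-4y^3-2xy,3y^4+xy^2)$, with coordinates $(u,v,w)$ in the target $\mathbb{R}^3$. A geometric swallowtail is the image of a germ $g:(\mathbb{R}^2,0)\to(\mathbb{R}^3,0)$ that is $\mathcal{A}$-equivalent to $f$, i.e. $g\circ\phi=\psi\circ f$ for germs of diffeomorphisms $\phi$ of $(\mathbb{R}^2,0)$ and $\psi$ of $(\mathbb{R}^3,0)$; its image is $\psi(X)$. The singular curve of $X$ is parametrised by $\alpha(t)=(-6t^2,8t^3,-3t^4)$ and its double point curve by $\beta(t)=(-2t^2,0,t^4)$. The tangent cone of $X$ at $0$ is the plane $w=0$, and its tangential line at $0$ is the $u$-axis (the common limiting tangent direction at $0$ of the singular and double point curves). The singular curve, double point curve, tangent cone and tangential line of $M=\psi(X)$ are the images of those of $X$ under $\psi$ (respectively under $d\psi_0$ for the last two). Convention: "tangent/transverse to the swallowtail" means tangent/transverse to its tangent cone, and "tangent/transverse to the singular curve" or "to the double point curve" means tangent/transverse to the tangential line. The pencil of planes obtained as limiting tangents to one of these curves is the pencil of planes through the origin containing the limiting tangent line of that curve at the swallowtail point; the limiting osculating plane is the limit at the swallowtail point of the osculating planes of the curve. $\mathcal{R}(X)$ is the group of germs of diffeomorphisms $\varphi$ of $(\mathbb{R}^3,0)$ with $(\varphi(X),0)=(X,0)$; function germs $g_1,g_2$ are $\mathcal{R}(X)$-equivalent if $g_2\circ\varphi^{-1}=g_1$ for some $\varphi\in\mathcal{R}(X)$. Let $\Theta(X)$ be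 the module of germs at $0$ of smooth vector fields tangent to $X$. The $\mathcal{R}_e^+(X)$-codimension of a germ $g$ is $\dim_{\mathbb{R}}\mathcal{M}_3/\{\xi\cdot g:\xi\in\Theta(X)\}$, where $\mathcal{M}_3$ is the maximal ideal of the ring of smooth function germs at $0\in\mathbb{R}^3$; in the presence of moduli (continuous parameters in the normal form) one uses the codimension of the stratum, i.e. this number minus the number of moduli. "Generic" means that for every $\nu\in S^2$ the submersion $h_\nu\circ\psi$ has (stratum) $\mathcal{R}_e^+(X)$-codimension $\le 2$; then $h_\nu\circ\psi$ is $\mathcal{R}(X)$-equivalent to one of the normal forms $\pm u$; $v+au^2$ ($a\neq0$); $v+au^3$ ($a\ne0$); $\pm w+au^2+bu^3$ ($a\neq 0,\pm\frac1{12},\pm\frac14$, $b\neq0$). *)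

theory Defs
  imports "HOL-Analysis.Analysis" "HOL-Library.Extended_Nat"
begin

text \<open>
  Germs at the origin are represented by total functions; only their values near the origin
  matter, and equality of germs is equality eventually in the filter \<open>nhds 0\<close>.
\<close>

primrec Ck_on :: "nat \<Rightarrow> 'a::real_normed_vector set \<Rightarrow> ('a \<Rightarrow> 'b::real_normed_vector) \<Rightarrow> bool" where
  "Ck_on 0 S f \<longleftrightarrow> continuous_on S f"
| "Ck_on (Suc k) S f \<longleftrightarrow>
     (\<forall>x\<in>S. f differentiable (at x)) \<and> (\<forall>v. Ck_on k S (\<lambda>x. frechet_derivative f (at x) v))"

definition smooth_on :: "'a::real_normed_vector set \<Rightarrow> ('a \<Rightarrow> 'b::real_normed_vector) \<Rightarrow> bool" where
  "smooth_on S f \<longleftrightarrow> (\<forall>k. Ck_on k S f)"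

definition smooth_germ :: "('a::real_normed_vector \<Rightarrow> 'b::real_normed_vector) \<Rightarrow> bool" where
  "smooth_germ f \<longleftrightarrow> (\<exists>U. open U \<and> 0 \<in> U \<and> smooth_on U f)"

definition diffeo_between ::
  "'a::real_normed_vector set \<Rightarrow> 'a set \<Rightarrow> ('a \<Rightarrow> 'a) \<Rightarrow> bool" where
  "diffeo_between U V \<phi> \<longleftrightarrow>
     open U \<and> open V \<and> bij_betw \<phi> U V \<and> smooth_on U \<phi> \<and> smooth_on V (inv_into U \<phi>)"

definition diffeo_germ :: "('a::real_normed_vector \<Rightarrow> 'a) \<Rightarrow> bool" where
  "diffeo_germ \<phi> \<longleftrightarrow> \<phi> 0 = 0 \<and> (\<exists>U V. 0 \<in> U \<and> diffeo_between U V \<phi>)"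

definition swallowtail_map :: "real^2 \<Rightarrow> real^3" where
  "swallowtail_map q = vector [q$1, -4 * (q$2)^3 - 2 * q$1 * q$2, 3 * (q$2)^4 + q$1 * (q$2)^2]"

text \<open>
  The map is proper and the origin is its own only preimage, so the image of the germ of
  \<^const>\<open>swallowtail_map\<close> at the origin is the germ at the origin of its global image.
\<close>

definition swallowtail :: "(real^3) set" where
  "swallowtail = range swallowtail_map"

definition singular_curve :: "real \<Rightarrow> real^3" where
  "singular_curve t = vector [-6 * t^2, 8 * t^3, -3 * t^4]"

definition double_point_curve :: "real \<Rightarrow> real^3" where
  "double_point_curve t = vector [-2 * t^2, 0, t^4]"

lemma singular_curve_eq: "singular_curve t = swallowtail_map (vector [-6 * t^2, t])"
  by (simp add: singular_curve_def swallowtail_map_def power_numeral_reduce algebra_simps)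

lemma double_point_curve_eq:
  "double_point_curve t = swallowtail_map (vector [-2 * t^2, t])"
  "double_point_curve t = swallowtail_map (vector [-2 * t^2, - t])"
  by (simp_all add: double_point_curve_def swallowtail_map_def power_numeral_reduce algebra_simps)

text \<open>
  The condition \<open>\<phi> ` (swallowtail \<inter> U) = swallowtail \<inter> V\<close> is the equality of set germs
  \<open>(\<phi>(X), 0) = (X, 0)\<close>, the neighbourhoods \<open>U\<close> and \<open>V\<close> being free to shrink.
\<close>

definition R_swallowtail :: "(real^3 \<Rightarrow> real^3) set" where
  "R_swallowtail = {\<phi>. \<phi> 0 = 0 \<and>
     (\<exists>U V. 0 \<in> U \<and> diffeo_between U V \<phi> \<and> \<phi> ` (swallowtail \<inter> U) = swallowtail \<inter> V)}"

text \<open>\<open>g\<^sub>2 \<circ> \<phi>\<inverse> = g\<^sub>1\<close> as germs, written as \<open>g\<^sub>2 = g\<^sub>1 \<circ> \<phi>\<close>.\<close>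

definition R_equivalent :: "(real^3 \<Rightarrow> real) \<Rightarrow> (real^3 \<Rightarrow> real) \<Rightarrow> bool" where
  "R_equivalent g1 g2 \<longleftrightarrow> (\<exists>\<phi>\<in>R_swallowtail. \<forall>\<^sub>F p in nhds 0. g2 p = g1 (\<phi> p))"

definition maximal_ideal :: "(real^3 \<Rightarrow> real) set" where
  "maximal_ideal = {h. smooth_germ h \<and> h 0 = 0}"

text \<open>
  A vector field is tangent to \<open>X\<close> if, as a derivation, it preserves the ideal of the smooth
  function germs that vanish on \<open>X\<close>.
\<close>

definition tangent_fields :: "(real^3 \<Rightarrow> real^3) set" where
  "tangent_fields = {\<xi>. smooth_germ \<xi> \<and>
     (\<forall>h :: real^3 \<Rightarrow> real. smooth_germ h \<and> (\<forall>\<^sub>F p in nhds 0. p \<in> swallowtail \<longrightarrow> h p = 0) \<longrightarrow>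
        (\<forall>\<^sub>F p in nhds 0. p \<in> swallowtail \<longrightarrow> frechet_derivative h (at p) (\<xi> p) = 0))}"

definition spans_modulo_tangent :: "(real^3 \<Rightarrow> real) set \<Rightarrow> (real^3 \<Rightarrow> real) \<Rightarrow> bool" where
  "spans_modulo_tangent B g \<longleftrightarrow> finite B \<and> B \<subseteq> maximal_ideal \<and>
     (\<forall>h\<in>maximal_ideal. \<exists>c. \<exists>\<xi>\<in>tangent_fields. \<forall>\<^sub>F p in nhds 0.
        h p = (\<Sum>b\<in>B. c b * b p) + frechet_derivative g (at p) (\<xi> p))"

text \<open>
  The dimension of the real vector space \<open>\<M>\<^sub>3 / {\<xi>\<cdot>g : \<xi> \<in> \<Theta>(X)}\<close>, as the least size of a
  spanning set; it is \<open>\<infinity>\<close> when no finite spanning set exists.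
\<close>

definition Re_codimension :: "(real^3 \<Rightarrow> real) \<Rightarrow> enat" where
  "Re_codimension g = (INF B \<in> {B. spans_modulo_tangent B g}. enat (card B))"

definition normal_form_u :: "(real^3 \<Rightarrow> real) set" where
  "normal_form_u = {\<lambda>p. s * p$1 | s. s \<in> {1, -1}}"

definition normal_form_vu2 :: "(real^3 \<Rightarrow> real) set" where
  "normal_form_vu2 = {\<lambda>p. p$2 + a * (p$1)^2 | a. a \<noteq> 0}"

definition normal_form_vu3 :: "(real^3 \<Rightarrow> real) set" where
  "normal_form_vu3 = {\<lambda>p. p$2 + a * (p$1)^3 | a. a \<noteq> 0}"

definition normal_form_w :: "(real^3 \<Rightarrow> real) set" where
  "normal_form_w = {\<lambda>p. s * p$3 + a * (p$1)^2 + b * (p$1)^3 | s a b.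
     s \<in> {1, -1} \<and> a \<notin> {0, 1/12, -1/12, 1/4, -1/4} \<and> b \<noteq> 0}"

definition normal_forms :: "(real^3 \<Rightarrow> real) set" where
  "normal_forms = normal_form_u \<union> normal_form_vu2 \<union> normal_form_vu3 \<union> normal_form_w"

definition height :: "real^3 \<Rightarrow> real^3 \<Rightarrow> real" where
  "height \<nu> p = p \<bullet> \<nu>"

text \<open>
  The codimension of the stratum is the codimension of the germ minus the number \<open>m\<close> of moduli,
  that is, of continuous parameters in its normal form: none for \<open>\<plusminus>u\<close>, one (\<open>a\<close>) for \<open>v + au\<^sup>2\<close>
  and \<open>v + au\<^sup>3\<close>, two (\<open>a\<close> and \<open>b\<close>) for \<open>\<plusminus>w + au\<^sup>2 + bu\<^sup>3\<close>.
\<close>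

definition generic_swallowtail :: "(real^3 \<Rightarrow> real^3) \<Rightarrow> bool" where
  "generic_swallowtail \<psi> \<longleftrightarrow>
     (\<forall>\<nu>\<in>sphere 0 1.
        \<exists>(N, m) \<in> {(normal_form_u, 0), (normal_form_vu2, 1), (normal_form_vu3, 1),
                   (normal_form_w, 2::nat)}.
          (\<exists>g\<in>N. R_equivalent (height \<nu> \<circ> \<psi>) g) \<and>
          Re_codimension (height \<nu> \<circ> \<psi>) - enat m \<le> 2)"

definition tangent_cone :: "(real^3 \<Rightarrow> real^3) \<Rightarrow> (real^3) set" where
  "tangent_cone \<psi> = frechet_derivative \<psi> (at 0) ` {p. p$3 = 0}"

definition tangential_line :: "(real^3 \<Rightarrow> real^3) \<Rightarrow> (real^3) set" where
  "tangential_line \<psi> = frechet_derivative \<psi> (at 0) ` {p. p$2 = 0 \<and> p$3 = 0}"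

definition transverse :: "(real^3) set \<Rightarrow> (real^3) set \<Rightarrow> bool" where
  "transverse P Q \<longleftrightarrow> {x + y | x y. x \<in> P \<and> y \<in> Q} = UNIV"

text \<open>
  By convention, transversality to the swallowtail is transversality to its tangent cone, and
  transversality to either of the two curves is transversality to their common tangential line.
\<close>

definition transverse_to_swallowtail :: "(real^3) set \<Rightarrow> (real^3 \<Rightarrow> real^3) \<Rightarrow> bool" where
  "transverse_to_swallowtail P \<psi> \<longleftrightarrow> transverse P (tangent_cone \<psi>)"

definition transverse_to_singular_curve :: "(real^3) set \<Rightarrow> (real^3 \<Rightarrow> real^3) \<Rightarrow> bool" where
  "transverse_to_singular_curve P \<psi> \<longleftrightarrow> transverse P (tangential_line \<psi>)"

definition transverse_to_double_point_curve :: "(real^3) set \<Rightarrow> (real^3 \<Rightarrow> real^3) \<Rightarrow> bool" where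
  "transverse_to_double_point_curve P \<psi> \<longleftrightarrow> transverse P (tangential_line \<psi>)"

text \<open>
  The curves are not immersed at \<open>t = 0\<close>. Tangent lines and osculating planes at \<open>t \<noteq> 0\<close> are
  given by their direction subspaces; as \<open>\<gamma> 0 = 0\<close> for the curves considered, the limiting
  line and plane pass through the origin and are themselves linear subspaces. Lines converge when
  suitably chosen unit direction vectors do, planes when suitably chosen unit normals do.
\<close>

definition limiting_tangent_line :: "(real \<Rightarrow> real^3) \<Rightarrow> (real^3) set \<Rightarrow> bool" where
  "limiting_tangent_line \<gamma> L \<longleftrightarrow>
     (\<exists>d d0. (\<forall>\<^sub>F t in at 0. norm (d t) = 1 \<and> span {vector_derivative \<gamma> (at t)} = span {d t}) \<and>
        (d \<longlongrightarrow> d0) (at 0) \<and> L = span {d0})"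

definition limiting_osculating_plane :: "(real \<Rightarrow> real^3) \<Rightarrow> (real^3) set \<Rightarrow> bool" where
  "limiting_osculating_plane \<gamma> P \<longleftrightarrow>
     (\<exists>n n0. (\<forall>\<^sub>F t in at 0. norm (n t) = 1 \<and>
           span {vector_derivative \<gamma> (at t),
                 vector_derivative (\<lambda>s. vector_derivative \<gamma> (at s)) (at t)} = {p. p \<bullet> n t = 0}) \<and>
        (n \<longlongrightarrow> n0) (at 0) \<and> P = {p. p \<bullet> n0 = 0})"

definition limiting_tangent_pencil :: "(real \<Rightarrow> real^3) \<Rightarrow> (real^3) set set" where
  "limiting_tangent_pencil \<gamma> =
     {P. subspace P \<and> dim P = 2 \<and> (\<exists>L. limiting_tangent_line \<gamma> L \<and> L \<subseteq> P)}"

end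

theory Submission
  imports Defs
begin

text \<open>
  A linear functional is conormal to a set at a point if it is \<open>o(\<bar>x - p\<bar>)\<close> along the set; by the
  chain rule, diffeomorphisms preserving the set act on its conormals. At a point \<open>p\<close> of the
  swallowtail whose quartic has one multiple root \<open>y\<close>, the functional \<open>(y\<^sup>2, y, 1)\<close> is conormal; at a
  point of the double point curve other than \<open>0\<close> two sheets cross and only \<open>0\<close> is conormal; at \<open>0\<close>
  the conormals are the multiples of \<open>dw\<close>. Hence the elements of \<open>\<R>(X)\<close> preserve the tangent cone
  and the double point curve, and so the tangential line, which gives the claims on transversality and
  pencils by comparing first derivatives. The double point curve is traced by
  \<open>C(s) = \<psi>(-2s, 0, s\<^sup>2)\<close> at \<open>s = t\<^sup>2\<close>, so its osculating planes are spanned by \<open>C'(s)\<close> and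
  \<open>C''(s)\<close>. For \<open>v + au\<^sup>3\<close> the height function is \<open>O(s\<^sup>3)\<close> along \<open>C\<close>, which makes
  \<open>\<nu>\<close> orthogonal to \<open>C'(0)\<close> and \<open>C''(0)\<close>. These two vectors are independent by genericity in the
  direction normal to the tangent cone.
\<close>

section \<open>Conormals of a set, under differentiable maps and along curves\<close>

definition conormal :: "'a::real_normed_vector set \<Rightarrow> 'a \<Rightarrow> ('a \<Rightarrow> real) \<Rightarrow> bool" where
  "conormal S p L \<longleftrightarrow> ((\<lambda>_. 0) has_derivative L) (at p within S)"

lemma conormal_linear: "conormal S p L \<Longrightarrow> linear L"
  unfolding conormal_def using has_derivative_linear by blast

text \<open>Chain rule for the zero function: \<open>conormal\<close> is encoded as a derivative
  within the set, so linearity and the \<open>o\<close>-estimate are transported together. Such a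
  derivative is local, so only the part of \<open>S\<close> in the open set \<open>U\<close>
  counts.\<close>

lemma conormal_pullback:
  assumes "open U" "p \<in> U" "(\<phi> has_derivative \<Phi>) (at p)" "\<phi> ` (S \<inter> U) \<subseteq> T"
    and "conormal T (\<phi> p) L"
  shows "conormal S p (L \<circ> \<Phi>)"
proof -
  have "(\<phi> has_derivative \<Phi>) (at p within S \<inter> U)"
    using assms(3) by (rule has_derivative_at_withinI)
  moreover have "((\<lambda>_. 0) has_derivative L) (at (\<phi> p) within \<phi> ` (S \<inter> U))"
    using assms(4,5) unfolding conormal_def by (rule has_derivative_subset[rotated])
  ultimately have "((\<lambda>_. 0) \<circ> \<phi> has_derivative L \<circ> \<Phi>) (at p within S \<inter> U)"
    by (rule diff_chain_within)
  moreover have "at p within S \<inter> U = at p within S"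
    using assms(1,2) by (intro at_within_nhd[of p U]) auto
  ultimately show ?thesis
    by (simp add: conormal_def o_def)
qed

text \<open>Pulling back along \<open>c\<close> gives a conormal of the whole real line, where the
  derivative of the zero function is unique. The curve is differentiated at the single point
  \<open>t\<close> only, which suits the cube-root parametrisation used at the origin.\<close>

lemma conormal_curve:
  assumes "(c has_vector_derivative d) (at t)" "range c \<subseteq> S" "conormal S (c t) L"
  shows "L d = 0"
proof -
  have c: "(c has_derivative (\<lambda>h. h *\<^sub>R d)) (at t)"
    using assms(1) by (simp add: has_vector_derivative_def)
  have "conormal UNIV t (L \<circ> (\<lambda>h. h *\<^sub>R d))"
    by (rule conormal_pullback[OF open_UNIV UNIV_I c _ assms(3)]) (use assms(2) in auto)
  then have "L \<circ> (\<lambda>h. h *\<^sub>R d) = (\<lambda>_. 0)"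
    unfolding conormal_def by (intro has_derivative_unique[of "\<lambda>_. 0" _ t]) auto
  then show ?thesis
    by (metis comp_apply scaleR_one)
qed

lemma vector_3_eq_sum:
  "(vector [a, b, c] :: real^3) = a *\<^sub>R axis 1 1 + b *\<^sub>R axis 2 1 + c *\<^sub>R axis 3 1"
  by (simp add: vec_eq_iff forall_3 axis_def)

lemma linear_axis_3:
  assumes "linear L"
  shows "L (x :: real^3) = x$1 *\<^sub>R L (axis 1 1) + x$2 *\<^sub>R L (axis 2 1) + x$3 *\<^sub>R L (axis 3 1)"
proof -
  have "x = vector [x$1, x$2, x$3]"
    by (simp add: vec_eq_iff forall_3)
  then have "L x = L (vector [x$1, x$2, x$3])"
    by simp
  then show ?thesis
    unfolding vector_3_eq_sum by (simp add: linear_add[OF assms] linear_scale[OF assms])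
qed

subsection \<open>Conormals of the swallowtail\<close>

text \<open>The point \<open>p\<close> stands for the quartic \<open>z\<^sup>4 + p\<^sub>1 z\<^sup>2 + p\<^sub>2 z + p\<^sub>3\<close>.\<close>

definition multiple_root :: "real^3 \<Rightarrow> real \<Rightarrow> bool" where
  "multiple_root p z \<longleftrightarrow>
     z^4 + p$1 * z^2 + p$2 * z + p$3 = 0 \<and> 4 * z^3 + 2 * p$1 * z + p$2 = 0"

text \<open>Subtracting \<open>z\<close> times the second equation from the first eliminates
  \<open>p$2\<close>. The result is the parametrisation \<open>swallowtail_map\<close> with the
  multiple root as its second argument.\<close>

lemma multiple_root_iff:
  "multiple_root p z \<longleftrightarrow> p$2 = -4 * z^3 - 2 * p$1 * z \<and> p$3 = 3 * z^4 + p$1 * z^2"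
proof -
  have "z^4 + p$1 * z^2 + p$2 * z + p$3
      = z * (4 * z^3 + 2 * p$1 * z + p$2) + (p$3 - (3 * z^4 + p$1 * z^2))"
    by (simp add: power_numeral_reduce algebra_simps)
  then have "z^4 + p$1 * z^2 + p$2 * z + p$3 = 0 \<longleftrightarrow> p$3 = 3 * z^4 + p$1 * z^2"
    if "4 * z^3 + 2 * p$1 * z + p$2 = 0"
    unfolding that by linarith
  moreover have "4 * z^3 + 2 * p$1 * z + p$2 = 0 \<longleftrightarrow> p$2 = -4 * z^3 - 2 * p$1 * z"
    by linarith
  ultimately show ?thesis
    unfolding multiple_root_def by blast
qed

lemma multiple_root_swallowtail_map: "multiple_root (swallowtail_map (vector [x, y])) y"
  by (simp add: multiple_root_iff swallowtail_map_def)

lemma mem_swallowtail_iff: "p \<in> swallowtail \<longleftrightarrow> (\<exists>z. multiple_root p z)"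
proof
  assume "p \<in> swallowtail"
  then obtain q where "p = swallowtail_map q"
    by (auto simp: swallowtail_def)
  moreover have "q = vector [q$1, q$2]"
    by (simp add: vec_eq_iff forall_2)
  ultimately show "\<exists>z. multiple_root p z"
    using multiple_root_swallowtail_map by metis
next
  assume "\<exists>z. multiple_root p z"
  then obtain z where "multiple_root p z" ..
  then have "p = swallowtail_map (vector [p$1, z])"
    by (simp add: multiple_root_iff swallowtail_map_def vec_eq_iff forall_3)
  then show "p \<in> swallowtail"
    by (auto simp: swallowtail_def)
qed

text \<open>The double point curve in the parameter \<open>s = t^2\<close>, with quartic
  \<open>(z^2 - s)^2\<close>. It is immersed at \<open>s = 0\<close>; for \<open>s < 0\<close> the
  double roots are not real and the point lies off the swallowtail.\<close>

definition double_parabola :: "real \<Rightarrow> real^3" where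
  "double_parabola s = vector [-2 * s, 0, s^2]"

lemma double_point_curve_parabola: "double_point_curve t = double_parabola (t^2)"
  by (simp add: double_point_curve_def double_parabola_def flip: power_mult)

lemma double_parabola_0 [simp]: "double_parabola 0 = 0"
  by (simp add: double_parabola_def vec_eq_iff forall_3)

lemma double_parabola_in_swallowtail: "0 \<le> s \<Longrightarrow> double_parabola s \<in> swallowtail"
  using double_point_curve_eq(1)[of "sqrt s"]
  by (auto simp: double_point_curve_parabola swallowtail_def)

text \<open>The equations for \<open>y\<close> and \<open>z\<close> are subtracted and divided by
  \<open>y - z\<close>. The first determines \<open>u\<close>; inserting it into the second leaves
  \<open>(y + z) * (y - z)^2 = 0\<close>, hence \<open>z = - y\<close>.\<close>

lemma two_multiple_roots:
  assumes "multiple_root p y" "multiple_root p z" "y \<noteq> z"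
  shows "0 < y^2" "p = double_parabola (y^2)"
proof -
  define u where "u = p$1"
  have e: "p$2 = -4 * y^3 - 2 * u * y" "p$3 = 3 * y^4 + u * y^2"
    "-4 * y^3 - 2 * u * y = -4 * z^3 - 2 * u * z" "3 * y^4 + u * y^2 = 3 * z^4 + u * z^2"
    using assms(1,2) by (auto simp: multiple_root_iff u_def)
  have "(y - z) * (2 * (y^2 + y * z + z^2) + u) = 0"
    using e(3) by (simp add: power_numeral_reduce algebra_simps)
  with assms(3) have u: "u = - 2 * (y^2 + y * z + z^2)"
    by simp
  have "(y - z) * ((y + z) * (3 * (y^2 + z^2) + u)) = 0"
    using e(4) by (simp add: power_numeral_reduce algebra_simps)
  with assms(3) have "(y + z) * (3 * (y^2 + z^2) + u) = 0"
    by simp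
  moreover have "3 * (y^2 + z^2) + u = (y - z)^2"
    unfolding u by (simp add: power_numeral_reduce algebra_simps)
  ultimately have z: "z = - y"
    using assms(3) by auto
  with assms(3) show "0 < y^2"
    by auto
  have "u = - 2 * y^2"
    unfolding u z by (simp add: power_numeral_reduce algebra_simps)
  then show "p = double_parabola (y^2)"
    using e(1,2)
    by (simp add: double_parabola_def vec_eq_iff forall_3 power_numeral_reduce flip: u_def)
qed

text \<open>Near a root of multiplicity \<open>m\<close> the quotient of a polynomial by its
  derivative behaves like \<open>(z - y) / m\<close>, and here \<open>m\<close> is at least
  2.\<close>

lemma quartic_le_derivative:
  assumes "multiple_root p y"
  obtains \<eta> where "0 < \<eta>" "\<And>z. \<bar>z - y\<bar> < \<eta> \<Longrightarrow>
    \<bar>z^4 + p$1 * z^2 + p$2 * z + p$3\<bar> \<le> \<bar>z - y\<bar> * \<bar>4 * z^3 + 2 * p$1 * z + p$2\<bar>"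
proof -
  define c where "c = 6 * y^2 + p$1"
  have q: "z^4 + p$1 * z^2 + p$2 * z + p$3 = (z-y)^2 * ((z-y)^2 + 4*y*(z-y) + c)"
    "4 * z^3 + 2 * p$1 * z + p$2 = (z-y) * (4*(z-y)^2 + 12*y*(z-y) + 2*c)"
    for z
  proof -
    have "p$2 = -4 * y^3 - 2 * p$1 * y" "p$3 = 3 * y^4 + p$1 * y^2"
      using assms unfolding multiple_root_iff by blast+
    then show "z^4 + p$1 * z^2 + p$2 * z + p$3 = (z-y)^2 * ((z-y)^2 + 4*y*(z-y) + c)"
      "4 * z^3 + 2 * p$1 * z + p$2 = (z-y) * (4*(z-y)^2 + 12*y*(z-y) + 2*c)"
      unfolding c_def by algebra+
  qed
  have "\<forall>\<^sub>F z in nhds y. \<bar>(z-y)^2 + 4*y*(z-y) + c\<bar> \<le> \<bar>4*(z-y)^2 + 12*y*(z-y) + 2*c\<bar>"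
  proof -
    \<comment> \<open>The root \<open>y\<close> has multiplicity 2, 3 or 4 respectively;
      \<open>2 * c\<close> is the second derivative of the quartic at \<open>y\<close>. For
      multiplicity 3 a further factor \<open>z - y\<close> is split off before limits are
      compared.\<close>
    consider "c \<noteq> 0" | "c = 0" "y \<noteq> 0" | "c = 0" "y = 0" by blast
    then show ?thesis
    proof cases
      case 1
      have "((\<lambda>z. \<bar>4*(z-y)^2 + 12*y*(z-y) + 2*c\<bar> - \<bar>(z-y)^2 + 4*y*(z-y) + c\<bar>) \<longlongrightarrow>
          \<bar>4*(y-y)^2 + 12*y*(y-y) + 2*c\<bar> - \<bar>(y-y)^2 + 4*y*(y-y) + c\<bar>) (nhds y)"
        by (intro tendsto_intros filterlim_ident)
      then have "\<forall>\<^sub>F z in nhds y.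
          0 < \<bar>4*(z-y)^2 + 12*y*(z-y) + 2*c\<bar> - \<bar>(z-y)^2 + 4*y*(z-y) + c\<bar>"
        by (rule order_tendstoD) (use 1 in simp)
      then show ?thesis
        by (rule eventually_mono) simp
    next
      case 2
      have "((\<lambda>z. \<bar>4*(z-y) + 12*y\<bar> - \<bar>(z-y) + 4*y\<bar>) \<longlongrightarrow>
          \<bar>4*(y-y) + 12*y\<bar> - \<bar>(y-y) + 4*y\<bar>) (nhds y)"
        by (intro tendsto_intros filterlim_ident)
      then have "\<forall>\<^sub>F z in nhds y. 0 < \<bar>4*(z-y) + 12*y\<bar> - \<bar>(z-y) + 4*y\<bar>"
        by (rule order_tendstoD) (use 2 in simp)
      then show ?thesis
      proof (rule eventually_mono)
        fix z assume "0 < \<bar>4*(z-y) + 12*y\<bar> - \<bar>(z-y) + 4*y\<bar>"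
        then have "\<bar>z-y\<bar> * \<bar>(z-y) + 4*y\<bar> \<le> \<bar>z-y\<bar> * \<bar>4*(z-y) + 12*y\<bar>"
          by (intro mult_left_mono) auto
        moreover have "(z-y)^2 + 4*y*(z-y) + c = (z-y) * ((z-y) + 4*y)"
          "4*(z-y)^2 + 12*y*(z-y) + 2*c = (z-y) * (4*(z-y) + 12*y)"
          using 2 by (auto simp: power_numeral_reduce algebra_simps)
        ultimately show "\<bar>(z-y)^2 + 4*y*(z-y) + c\<bar> \<le> \<bar>4*(z-y)^2 + 12*y*(z-y) + 2*c\<bar>"
          by (simp add: abs_mult)
      qed
    next
      case 3
      then show ?thesis by simp
    qed
  qed
  then obtain \<eta> where "0 < \<eta>" and \<eta>: "\<And>z. dist z y < \<eta> \<Longrightarrow>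
      \<bar>(z-y)^2 + 4*y*(z-y) + c\<bar> \<le> \<bar>4*(z-y)^2 + 12*y*(z-y) + 2*c\<bar>"
    unfolding eventually_nhds_metric by blast
  show thesis
  proof
    fix z assume "\<bar>z - y\<bar> < \<eta>"
    then have "(z-y)^2 * \<bar>(z-y)^2 + 4*y*(z-y) + c\<bar>
        \<le> (z-y)^2 * \<bar>4*(z-y)^2 + 12*y*(z-y) + 2*c\<bar>"
      using \<eta>[of z] by (intro mult_left_mono) (auto simp: dist_real_def)
    then show "\<bar>z^4 + p$1 * z^2 + p$2 * z + p$3\<bar> \<le> \<bar>z - y\<bar> * \<bar>4 * z^3 + 2 * p$1 * z + p$2\<bar>"
      unfolding q abs_mult by (simp add: power2_eq_square)
  qed fact
qed

text \<open>The quartic of \<open>x\<close> and its derivative vanish at \<open>z\<close>, so the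
  values for \<open>p\<close> involve only differences of coefficients.\<close>

lemma quartic_perturbation:
  assumes "multiple_root x z"
  shows "\<bar>z^4 + p$1 * z^2 + p$2 * z + p$3\<bar> \<le> (z^2 + \<bar>z\<bar> + 1) * norm (x - p)"
    and "\<bar>4 * z^3 + 2 * p$1 * z + p$2\<bar> \<le> (2 * \<bar>z\<bar> + 1) * norm (x - p)"
proof -
  have b: "\<bar>p$i - x$i\<bar> \<le> norm (x - p)" for i
    using component_le_norm_cart[of "p - x" i] by (simp add: norm_minus_commute)
  have "z^4 + p$1 * z^2 + p$2 * z + p$3 = z^2 * (p$1-x$1) + z * (p$2-x$2) + (p$3-x$3)"
    using assms by (auto simp: multiple_root_def algebra_simps)
  also have "\<bar>\<dots>\<bar> \<le> z^2 * \<bar>p$1-x$1\<bar> + \<bar>z\<bar> * \<bar>p$2-x$2\<bar> + \<bar>p$3-x$3\<bar>"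
    by (intro abs_triangle_ineq[THEN order_trans] add_mono) (auto simp: abs_mult)
  also have "\<dots> \<le> z^2 * norm (x-p) + \<bar>z\<bar> * norm (x-p) + norm (x-p)"
    by (intro add_mono mult_left_mono b) auto
  finally show "\<bar>z^4 + p$1 * z^2 + p$2 * z + p$3\<bar> \<le> (z^2 + \<bar>z\<bar> + 1) * norm (x - p)"
    by (simp add: algebra_simps)
  have "4 * z^3 + 2 * p$1 * z + p$2 = 2 * z * (p$1-x$1) + (p$2-x$2)"
    using assms by (auto simp: multiple_root_def algebra_simps)
  also have "\<bar>\<dots>\<bar> \<le> 2 * \<bar>z\<bar> * \<bar>p$1-x$1\<bar> + \<bar>p$2-x$2\<bar>"
    by (intro abs_triangle_ineq[THEN order_trans] add_mono) (auto simp: abs_mult)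
  also have "\<dots> \<le> 2 * \<bar>z\<bar> * norm (x-p) + norm (x-p)"
    by (intro add_mono mult_left_mono b) auto
  finally show "\<bar>4 * z^3 + 2 * p$1 * z + p$2\<bar> \<le> (2 * \<bar>z\<bar> + 1) * norm (x - p)"
    by (simp add: algebra_simps)
qed

text \<open>For larger \<open>z\<close> the right side of \<open>3 * z^4 = x$3 - x$1 * z^2\<close>
  would be at most \<open>2 * z^4\<close>. The bound confines multiple roots to a compact
  interval.\<close>

lemma multiple_root_bound:
  assumes "multiple_root x z"
  shows "\<bar>z\<bar> \<le> 1 + norm x"
proof (rule ccontr)
  define M where "M = norm x"
  assume "\<not> \<bar>z\<bar> \<le> 1 + norm x"
  then have z: "1 + M < \<bar>z\<bar>" and "0 \<le> M"
    by (auto simp: M_def)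
  have b: "\<bar>x$i\<bar> \<le> M" for i
    unfolding M_def by (rule component_le_norm_cart)
  have "(1+M)*1 \<le> \<bar>z\<bar> * \<bar>z\<bar>"
    using z \<open>0 \<le> M\<close> by (intro mult_mono) auto
  then have z2: "1 + M \<le> z^2"
    by (simp add: power2_eq_square)
  have "3 * z^4 = x$3 - x$1 * z^2"
    using assms by (simp add: multiple_root_iff)
  also have "\<dots> \<le> M + M * z^2"
  proof -
    have "- x$1 * z^2 \<le> M * z^2"
      using b[of 1] by (intro mult_right_mono) auto
    then show ?thesis
      using b[of 3] by simp
  qed
  also have "\<dots> \<le> z^2 * z^2 + z^2 * z^2"
    using z2 \<open>0 \<le> M\<close> mult_mono[of 1 "z^2" "M" "z^2"] by (intro add_mono mult_right_mono) auto
  finally have "z^4 \<le> 0"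
    by (simp add: power_numeral_reduce)
  then show False
    using z \<open>0 \<le> M\<close> by (auto simp: power_le_zero_eq)
qed

text \<open>Compactness: away from \<open>y\<close> the function \<open>F\<close> has a positive
  minimum on the interval that contains all relevant roots, whereas at a multiple root of a nearby
  \<open>x\<close> it is bounded by a multiple of \<open>norm (x - p)\<close>.\<close>

lemma multiple_root_near:
  assumes "multiple_root p y" "\<And>z. multiple_root p z \<Longrightarrow> z = y" "0 < \<eta>"
  obtains \<delta> where "0 < \<delta>"
    "\<And>x z. multiple_root x z \<Longrightarrow> norm (x - p) < \<delta> \<Longrightarrow> \<bar>z - y\<bar> < \<eta>"
proof -
  \<comment> \<open>For \<open>norm (x - p) < 1\<close> one has
    \<open>norm x \<le> 1 + norm p\<close>, and the root bound adds another 1.\<close>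
  define R where "R = 2 + norm p"
  define K where "K = {-R..R} - ball y \<eta>"
  define F where "F z = \<bar>z^4 + p$1 * z^2 + p$2 * z + p$3\<bar> + \<bar>4 * z^3 + 2 * p$1 * z + p$2\<bar>" for z
  have "compact K"
    unfolding K_def by (intro compact_diff) auto
  have pos: "0 < F z" if "z \<in> K" for z
  proof -
    have "z \<noteq> y"
      using that \<open>0 < \<eta>\<close> by (auto simp: K_def)
    then show ?thesis
      using assms(2)[of z] unfolding F_def multiple_root_def by linarith
  qed
  have "\<exists>m>0. \<forall>z\<in>K. m \<le> F z"
  proof (cases "K = {}")
    case True
    then show ?thesis using zero_less_one by blast
  next
    case False
    have "continuous_on K F"
      unfolding F_def by (intro continuous_intros)
    from continuous_attains_inf[OF \<open>compact K\<close> False this] show ?thesis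
      using pos by blast
  qed
  then obtain m where m: "0 < m" "\<And>z. z \<in> K \<Longrightarrow> m \<le> F z"
    by blast
  have R: "2 \<le> R"
    by (simp add: R_def)
  \<comment> \<open>The sum of the two perturbation factors with \<open>R\<close> in place of the
    absolute value of \<open>z\<close>.\<close>
  define N where "N = R^2 + 3 * R + 2"
  have N: "0 < N"
    using R by (simp add: N_def add_pos_pos)
  show thesis
  proof
    show "0 < min 1 (m / N)"
      using m(1) N by simp
    fix x z assume xz: "multiple_root x z" "norm (x - p) < min 1 (m / N)"
    have "norm x \<le> 1 + norm p"
      using xz(2) norm_triangle_sub[of x p] by simp
    then have zR: "\<bar>z\<bar> \<le> R"
      using multiple_root_bound[OF xz(1)] by (simp add: R_def)
    then have "z^2 \<le> R^2"
      by (metis abs_ge_zero power2_abs power_mono)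
    have "F z \<le> ((z^2 + \<bar>z\<bar> + 1) + (2 * \<bar>z\<bar> + 1)) * norm (x - p)"
      using quartic_perturbation[OF xz(1), of p] by (simp add: F_def algebra_simps)
    also have "\<dots> \<le> N * norm (x - p)"
      using zR \<open>z^2 \<le> R^2\<close> unfolding N_def by (intro mult_right_mono) auto
    also have "\<dots> < m"
      using xz(2) N by (simp add: field_simps)
    finally have "z \<notin> K"
      using m(2)[of z] by auto
    then show "\<bar>z - y\<bar> < \<eta>"
      using zR by (auto simp: K_def dist_real_def)
  qed
qed

text \<open>Let \<open>z\<close> be a multiple root of a nearby \<open>x\<close>. With
  \<open>z\<close> in place of \<open>y\<close> the functional takes at \<open>x - p\<close> minus
  the value of the quartic of \<open>p\<close> at \<open>z\<close>, and this is at most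
  \<open>\<bar>z - y\<bar>\<close> times a derivative of size \<open>O(norm (x - p))\<close>.
  Replacing \<open>z\<close> by \<open>y\<close> costs another
  \<open>O(\<bar>z - y\<bar> * norm (x - p))\<close>, and uniqueness of the root makes
  \<open>z\<close> tend to \<open>y\<close>.\<close>

lemma conormal_unique_root:
  assumes "multiple_root p y" "\<And>z. multiple_root p z \<Longrightarrow> z = y"
  shows "conormal swallowtail p (\<lambda>\<xi>. y^2 * \<xi>$1 + y * \<xi>$2 + \<xi>$3)" (is "conormal _ _ ?L")
proof -
  obtain \<eta> where "0 < \<eta>" and \<eta>: "\<And>z. \<bar>z - y\<bar> < \<eta> \<Longrightarrow>
    \<bar>z^4 + p$1 * z^2 + p$2 * z + p$3\<bar> \<le> \<bar>z - y\<bar> * \<bar>4 * z^3 + 2 * p$1 * z + p$2\<bar>"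
    using quartic_le_derivative[OF assms(1)] by blast
  \<comment> \<open>Bounds \<open>2 * \<bar>z\<bar> + 1 + \<bar>y + z\<bar> + 1\<close> when
    \<open>\<bar>z - y\<bar> < 1\<close>.\<close>
  define N where "N = 4 * \<bar>y\<bar> + 5"
  have N: "0 < N" by (simp add: N_def)
  have key: "\<bar>?L (x - p)\<bar> \<le> \<bar>z - y\<bar> * N * norm (x - p)"
    if xz: "multiple_root x z" "\<bar>z - y\<bar> < \<eta>" "\<bar>z - y\<bar> < 1" for x z
  proof -
    have b: "\<bar>x$i - p$i\<bar> \<le> norm (x - p)" for i
      using component_le_norm_cart[of "x - p" i] by simp
    have "?L (x - p) = - (z^4 + p$1 * z^2 + p$2 * z + p$3)
        + ((y - z) * (y + z) * (x$1 - p$1) + (y - z) * (x$2 - p$2))"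
      using xz(1) by (auto simp: multiple_root_def power2_eq_square algebra_simps)
    also have "\<bar>\<dots>\<bar> \<le> \<bar>z^4 + p$1 * z^2 + p$2 * z + p$3\<bar>
        + (\<bar>z - y\<bar> * \<bar>y + z\<bar> * \<bar>x$1 - p$1\<bar> + \<bar>z - y\<bar> * \<bar>x$2 - p$2\<bar>)"
      by (intro abs_triangle_ineq[THEN order_trans] add_mono)
        (auto simp: abs_mult abs_minus_commute)
    also have "\<bar>z^4 + p$1 * z^2 + p$2 * z + p$3\<bar> \<le> \<bar>z - y\<bar> * ((2 * \<bar>z\<bar> + 1) * norm (x - p))"
      using \<eta>[OF xz(2)] quartic_perturbation(2)[OF xz(1), of p]
      by (meson abs_ge_zero mult_left_mono order_trans)
    also have "\<bar>z - y\<bar> * \<bar>y + z\<bar> * \<bar>x$1 - p$1\<bar> + \<bar>z - y\<bar> * \<bar>x$2 - p$2\<bar>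
        \<le> \<bar>z - y\<bar> * \<bar>y + z\<bar> * norm (x - p) + \<bar>z - y\<bar> * norm (x - p)"
      by (intro add_mono mult_left_mono b) auto
    finally have "\<bar>?L (x - p)\<bar> \<le> \<bar>z - y\<bar> * (2 * \<bar>z\<bar> + 1 + \<bar>y + z\<bar> + 1) * norm (x - p)"
      by (simp add: algebra_simps)
    also have "\<dots> \<le> \<bar>z - y\<bar> * N * norm (x - p)"
      using xz(3) unfolding N_def by (intro mult_right_mono mult_left_mono) auto
    finally show ?thesis .
  qed
  have bl: "bounded_linear ?L"
    by (intro bounded_linear_intros bounded_linear_vec_nth)
  show ?thesis
    unfolding conormal_def has_derivative_within_alt
  proof (intro conjI bl allI impI)
    fix e :: real assume "0 < e"
    then have "0 < min (min \<eta> 1) (e / N)"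
      using \<open>0 < \<eta>\<close> N by simp
    from multiple_root_near[OF assms(1,2) this]
    obtain \<delta> where \<delta>: "0 < \<delta>" "\<And>x z. multiple_root x z \<Longrightarrow> norm (x - p) < \<delta> \<Longrightarrow>
        \<bar>z - y\<bar> < min (min \<eta> 1) (e / N)"
      by metis
    show "\<exists>d>0. \<forall>x\<in>swallowtail. norm (x - p) < d \<longrightarrow>
        norm (0 - 0 - ?L (x - p)) \<le> e * norm (x - p)"
    proof (intro exI[of _ \<delta>] conjI ballI impI \<delta>(1))
      fix x assume "x \<in> swallowtail" "norm (x - p) < \<delta>"
      then obtain z where z: "multiple_root x z" and zy: "\<bar>z - y\<bar> < min (min \<eta> 1) (e / N)"
        using \<delta>(2) by (auto simp: mem_swallowtail_iff)
      have "\<bar>?L (x - p)\<bar> \<le> \<bar>z - y\<bar> * N * norm (x - p)"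
        using key[OF z] zy by simp
      also have "\<dots> \<le> e * norm (x - p)"
        using zy N by (intro mult_right_mono) (auto simp: field_simps)
      finally show "norm (0 - 0 - ?L (x - p)) \<le> e * norm (x - p)"
        by simp
    qed
  qed
qed

section \<open>Conormals at double points and at the origin\<close>

lemma swallowtail_map_eq_sum:
  "swallowtail_map (vector [x, y]) = x *\<^sub>R axis 1 1 + (-4 * y^3 - 2 * x * y) *\<^sub>R axis 2 1
     + (3 * y^4 + x * y^2) *\<^sub>R axis 3 1"
  by (simp add: swallowtail_map_def vector_3_eq_sum)

text \<open>A conormal annihilates both partial derivatives of the parametrisation. The factor
  \<open>12 * y^2 + 2 * x\<close> vanishes exactly along the singular curve, where the second
  condition is empty.\<close>

lemma conormal_swallowtail_map:
  assumes "conormal swallowtail (swallowtail_map (vector [x, y])) L"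
  shows "L (axis 1 1) - 2 * y * L (axis 2 1) + y^2 * L (axis 3 1) = 0"
    and "(12 * y^2 + 2 * x) * (L (axis 2 1) - y * L (axis 3 1)) = 0"
proof -
  have L: "linear L"
    using assms by (rule conormal_linear)
  have "((\<lambda>x. swallowtail_map (vector [x, y])) has_vector_derivative
      axis 1 1 - (2 * y) *\<^sub>R axis 2 1 + y^2 *\<^sub>R axis 3 1) (at x)"
    unfolding swallowtail_map_eq_sum by (auto intro!: derivative_eq_intros)
  from conormal_curve[OF this _ assms]
  have "L (axis 1 1 - (2 * y) *\<^sub>R axis 2 1 + y^2 *\<^sub>R axis 3 1) = 0"
    by (auto simp: swallowtail_def)
  then show "L (axis 1 1) - 2 * y * L (axis 2 1) + y^2 * L (axis 3 1) = 0"
    by (simp add: linear_add[OF L] linear_diff[OF L] linear_scale[OF L])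
  have "((\<lambda>y. swallowtail_map (vector [x, y])) has_vector_derivative
      (-12 * y^2 - 2 * x) *\<^sub>R axis 2 1 + (12 * y^3 + 2 * x * y) *\<^sub>R axis 3 1) (at y)"
    unfolding swallowtail_map_eq_sum by (auto intro!: derivative_eq_intros)
  from conormal_curve[OF this _ assms]
  have "L ((-12 * y^2 - 2 * x) *\<^sub>R axis 2 1 + (12 * y^3 + 2 * x * y) *\<^sub>R axis 3 1) = 0"
    by (auto simp: swallowtail_def)
  then show "(12 * y^2 + 2 * x) * (L (axis 2 1) - y * L (axis 3 1)) = 0"
    unfolding linear_add[OF L] linear_scale[OF L] real_scaleR_def by algebra
qed

text \<open>The sheets with parameters \<open>y\<close> and \<open>-y\<close> are both immersed here
  and have different tangent planes, which together leave no nonzero functional.\<close>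

lemma conormal_double_parabola:
  assumes "conormal swallowtail (double_parabola s) L" "0 < s"
  shows "L = (\<lambda>_. 0)"
proof -
  define y where "y = sqrt s"
  have y: "y \<noteq> 0" and s: "s = y^2"
    using \<open>0 < s\<close> by (auto simp: y_def)
  have "double_parabola s = swallowtail_map (vector [-2 * y^2, y])"
    "double_parabola s = swallowtail_map (vector [-2 * y^2, -y])"
    unfolding s double_point_curve_parabola[symmetric] by (fact double_point_curve_eq)+
  with assms(1) have c:
    "conormal swallowtail (swallowtail_map (vector [-2 * y^2, y])) L"
    "conormal swallowtail (swallowtail_map (vector [-2 * y^2, -y])) L"
    by simp_all
  have "L (axis 2 1) = y * L (axis 3 1)" "L (axis 2 1) = - y * L (axis 3 1)"
    using conormal_swallowtail_map(2)[OF c(1)] conormal_swallowtail_map(2)[OF c(2)] y by auto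
  then have "y * L (axis 3 1) = 0" "L (axis 2 1) = 0"
    by linarith+
  then have "L (axis 3 1) = 0" "L (axis 2 1) = 0"
    using y by simp_all
  with conormal_swallowtail_map(1)[OF c(1)] have "L (axis 1 1) = 0"
    by simp
  show ?thesis
  proof
    fix \<xi>
    show "L \<xi> = 0"
      unfolding linear_axis_3[OF conormal_linear[OF c(1)], of \<xi>]
      using \<open>L (axis 1 1) = 0\<close> \<open>L (axis 2 1) = 0\<close> \<open>L (axis 3 1) = 0\<close> by simp
  qed
qed

text \<open>A single multiple root would provide a conormal with value 1 on \<open>axis 3 1\<close>,
  so there are two distinct ones.\<close>

lemma double_parabola_if_no_conormal:
  assumes "p \<in> swallowtail" "\<And>L. conormal swallowtail p L \<Longrightarrow> L = (\<lambda>_. 0)"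
  obtains s where "0 < s" "p = double_parabola s"
proof -
  obtain y where y: "multiple_root p y"
    using assms(1) by (auto simp: mem_swallowtail_iff)
  have "\<exists>z. multiple_root p z \<and> z \<noteq> y"
  proof (rule ccontr)
    assume "\<nexists>z. multiple_root p z \<and> z \<noteq> y"
    then have "conormal swallowtail p (\<lambda>\<xi>. y^2 * \<xi>$1 + y * \<xi>$2 + \<xi>$3)"
      by (intro conormal_unique_root y) blast
    then have "(\<lambda>\<xi>::real^3. y^2 * \<xi>$1 + y * \<xi>$2 + \<xi>$3) = (\<lambda>_. 0)"
      by (rule assms(2))
    then have "y^2 * (axis 3 1 :: real^3)$1 + y * (axis 3 1 :: real^3)$2 + (axis 3 1 :: real^3)$3 = 0"
      by metis
    then show False
      by (simp add: axis_def)
  qed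
  then obtain z where "multiple_root p z" "z \<noteq> y" by blast
  then show thesis
    using two_multiple_roots[OF y] that by metis
qed

lemma conormal_swallowtail_0:
  "conormal swallowtail 0 L \<longleftrightarrow> linear L \<and> L (axis 1 1) = 0 \<and> L (axis 2 1) = 0"
proof
  assume c: "conormal swallowtail 0 L"
  then have L: "linear L" by (rule conormal_linear)
  have "swallowtail_map (vector [0, 0]) = 0"
    by (simp add: swallowtail_map_eq_sum)
  then have "L (axis 1 1) = 0"
    using conormal_swallowtail_map(1)[of 0 0 L] c by simp
  moreover have "L (axis 2 1) = 0"
  proof -
    \<comment> \<open>At the origin the partial derivative in \<open>y\<close> vanishes and says
      nothing about \<open>axis 2 1\<close>. Along \<open>x = 0\<close> with a cube root as
      parameter, the second coordinate becomes \<open>s\<close> itself and the third is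
      \<open>o(s)\<close>.\<close>
    define r where "r s = root 3 (s / 4)" for s :: real
    define k where "k s = swallowtail_map (vector [0, - r s])" for s
    have r3: "r s ^ 3 = s / 4" for s
      by (simp add: r_def odd_real_root_pow)
    have r4: "r s ^ 4 = s * r s / 4" for s
      using r3[of s] by (simp add: power_numeral_reduce)
    have k: "k = (\<lambda>s. s *\<^sub>R axis 2 1 + (3 / 4 * (s * r s)) *\<^sub>R axis 3 1)"
      unfolding k_def swallowtail_map_eq_sum by (simp add: r3 r4)
    have "isCont r 0"
      unfolding r_def by (intro continuous_intros) simp
    then have "(r \<longlongrightarrow> 0) (at 0)"
      by (simp add: isCont_def r_def)
    \<comment> \<open>The cube root is not differentiable at 0, but the difference quotient of
      \<open>s * r s\<close> there is \<open>r s\<close>, which tends to 0.\<close>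
    then have "((\<lambda>s. s * r s) has_real_derivative 0) (at 0)"
      unfolding DERIV_def by (rule Lim_transform_eventually) (auto simp: eventually_at_filter)
    then have "(k has_vector_derivative (0 *\<^sub>R 0 + 1 *\<^sub>R axis 2 1)
        + ((3 / 4 * (0 * r 0)) *\<^sub>R 0 + (3 / 4 * 0) *\<^sub>R axis 3 1)) (at 0)"
      unfolding k
      by (intro has_vector_derivative_add has_vector_derivative_scaleR DERIV_cmult DERIV_ident) auto
    then have "(k has_vector_derivative axis 2 1) (at 0)"
      by simp
    moreover have "k 0 = 0"
      by (simp add: k)
    ultimately show ?thesis
      using c by (intro conormal_curve[of k _ 0 swallowtail]) (auto simp: k_def swallowtail_def)
  qed
  ultimately show "linear L \<and> L (axis 1 1) = 0 \<and> L (axis 2 1) = 0"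
    using L by simp
next
  assume L: "linear L \<and> L (axis 1 1) = 0 \<and> L (axis 2 1) = 0"
  have m: "multiple_root 0 z \<longleftrightarrow> z = 0" for z
    by (auto simp: multiple_root_iff)
  have "conormal swallowtail 0 (\<lambda>\<xi>. 0^2 * \<xi>$1 + 0 * \<xi>$2 + \<xi>$3)"
    by (rule conormal_unique_root) (auto simp: m)
  then have "((\<lambda>_. L (axis 3 1) * 0) has_derivative (\<lambda>\<xi>. L (axis 3 1) * \<xi>$3)) (at 0 within swallowtail)"
    unfolding conormal_def by (intro has_derivative_mult_right) simp
  moreover have "(\<lambda>\<xi>. L (axis 3 1) * \<xi>$3) = L"
  proof
    fix \<xi>
    show "L (axis 3 1) * \<xi>$3 = L \<xi>"
      using L linear_axis_3[of L \<xi>] by simp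
  qed
  ultimately show "conormal swallowtail 0 L"
    by (simp add: conormal_def)
qed

subsection \<open>Action of \<open>\<R>(X)\<close> on conormals and on the double point curve\<close>

lemma smooth_on_differentiable: "smooth_on U f \<Longrightarrow> x \<in> U \<Longrightarrow> f differentiable (at x)"
  unfolding smooth_on_def by (metis Ck_on.simps(2))

text \<open>The inverse is smooth by definition, so the chain rule applied to both composites
  inverts the derivative.\<close>

lemma diffeo_between_derivative:
  assumes "diffeo_between U V \<phi>" "p \<in> U" "(\<phi> has_derivative \<Phi>) (at p)"
  obtains \<Psi> where "(inv_into U \<phi> has_derivative \<Psi>) (at (\<phi> p))" "\<Psi> \<circ> \<Phi> = id" "\<Phi> \<circ> \<Psi> = id"
proof -
  define \<theta> where "\<theta> = inv_into U \<phi>"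
  have U: "open U" and V: "open V" and bij: "bij_betw \<phi> U V" and "smooth_on V \<theta>"
    using assms(1) by (auto simp: diffeo_between_def \<theta>_def)
  have "\<phi> p \<in> V"
    using bij assms(2) by (rule bij_betwE[THEN bspec])
  then obtain \<Psi> where \<Psi>: "(\<theta> has_derivative \<Psi>) (at (\<phi> p))"
    using smooth_on_differentiable[OF \<open>smooth_on V \<theta>\<close>] by (auto simp: differentiable_def)
  have \<theta>: "\<theta> (\<phi> x) = x" if "x \<in> U" for x
    using bij that by (simp add: \<theta>_def bij_betw_inv_into_left)
  have \<phi>: "\<phi> (\<theta> y) = y" if "y \<in> V" for y
    using bij that by (simp add: \<theta>_def bij_betw_inv_into_right)
  have "(\<theta> \<circ> \<phi> has_derivative \<Psi> \<circ> \<Phi>) (at p)"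
    using assms(3) \<Psi> by (rule diff_chain_at)
  then have "(id has_derivative \<Psi> \<circ> \<Phi>) (at p)"
    by (rule has_derivative_transform_within_open[OF _ U assms(2)]) (simp add: \<theta>)
  then have 1: "\<Psi> \<circ> \<Phi> = id"
    by (rule has_derivative_unique) (simp add: id_def)
  have "(\<phi> \<circ> \<theta> has_derivative \<Phi> \<circ> \<Psi>) (at (\<phi> p))"
    using \<Psi> assms(3) by (intro diff_chain_at) (simp_all add: \<theta> assms(2))
  then have "(id has_derivative \<Phi> \<circ> \<Psi>) (at (\<phi> p))"
    by (rule has_derivative_transform_within_open[OF _ V \<open>\<phi> p \<in> V\<close>]) (simp add: \<phi>)
  then have 2: "\<Phi> \<circ> \<Psi> = id"
    by (rule has_derivative_unique) (simp add: id_def)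
  show thesis
    using \<Psi> 1 2 by (intro that) (simp_all add: \<theta>_def)
qed

text \<open>One direction pulls back along \<open>\<phi>\<close>, the other along its local inverse,
  which also maps the swallowtail to itself.\<close>

lemma R_swallowtail_conormal_0:
  assumes "\<phi> \<in> R_swallowtail" "(\<phi> has_derivative \<Phi>) (at 0)"
  shows "conormal swallowtail 0 (L \<circ> \<Phi>) \<longleftrightarrow> conormal swallowtail 0 L"
proof -
  obtain U V where "\<phi> 0 = 0" "0 \<in> U" and d: "diffeo_between U V \<phi>"
    and im: "\<phi> ` (swallowtail \<inter> U) = swallowtail \<inter> V"
    using assms(1) by (auto simp: R_swallowtail_def)
  have U: "open U" "open V" and bij: "bij_betw \<phi> U V"
    using d by (auto simp: diffeo_between_def)
  have "0 \<in> V"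
    using bij \<open>\<phi> 0 = 0\<close> \<open>0 \<in> U\<close> bij_betwE by metis
  obtain \<Psi> where \<Psi>: "(inv_into U \<phi> has_derivative \<Psi>) (at (\<phi> 0))" "\<Phi> \<circ> \<Psi> = id"
    using diffeo_between_derivative[OF d \<open>0 \<in> U\<close> assms(2)] by blast
  have inv: "inv_into U \<phi> 0 = 0"
    using bij_betw_inv_into_left[OF bij \<open>0 \<in> U\<close>] \<open>\<phi> 0 = 0\<close> by simp
  have "inv_into U \<phi> ` (swallowtail \<inter> V) \<subseteq> swallowtail"
    unfolding im[symmetric] using bij_betw_inv_into_left[OF bij] by force
  then have "conormal swallowtail 0 (L \<circ> \<Phi> \<circ> \<Psi>)" if "conormal swallowtail 0 (L \<circ> \<Phi>)"
    using that \<Psi>(1) inv U \<open>0 \<in> V\<close> \<open>\<phi> 0 = 0\<close>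
    by (intro conormal_pullback[of V, where \<phi> = "inv_into U \<phi>" and T = swallowtail and L = "L \<circ> \<Phi>" and \<Phi> = \<Psi>]) simp_all
  moreover have "conormal swallowtail 0 (L \<circ> \<Phi>)" if "conormal swallowtail 0 L"
    using that assms(2) im U \<open>0 \<in> U\<close> \<open>\<phi> 0 = 0\<close>
    by (intro conormal_pullback[of U, where \<phi> = \<phi> and T = swallowtail and L = L and \<Phi> = \<Phi>]) auto
  ultimately show ?thesis
    using \<Psi>(2) by (auto simp: comp_assoc)
qed

section \<open>The double point curve in its regular parameter and its image under
  \<open>R_swallowtail\<close>\<close>

lemma double_parabola_eq_sum: "double_parabola s = (-2 * s) *\<^sub>R axis 1 1 + (s^2) *\<^sub>R axis 3 1"
  by (simp add: double_parabola_def vector_3_eq_sum)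

lemma has_vector_derivative_double_parabola:
  "(double_parabola has_vector_derivative (-2) *\<^sub>R axis 1 1 + (2 * s) *\<^sub>R axis 3 1) (at s)"
  unfolding double_parabola_eq_sum by (auto intro!: derivative_eq_intros)

lemma isCont_double_parabola: "isCont double_parabola s"
  using has_vector_derivative_double_parabola has_vector_derivative_continuous by blast

lemma eventually_double_parabola:
  assumes "open U" "0 \<in> U"
  shows "\<forall>\<^sub>F s in nhds 0. double_parabola s \<in> U"
proof -
  have "(double_parabola \<longlongrightarrow> double_parabola 0) (nhds 0)"
    using isCont_double_parabola by (metis isCont_def tendsto_at_iff_tendsto_nhds)
  then show ?thesis
    using assms by (auto simp: tendsto_def)
qed

text \<open>
  The double point curve without \<open>0\<close> is the set of points of the swallowtail where only the zero
  functional is conormal, so it is preserved.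
\<close>

lemma R_swallowtail_double_parabola:
  assumes "\<phi> \<in> R_swallowtail"
  obtains \<sigma> where "\<forall>\<^sub>F s in at_right 0. 0 < \<sigma> s \<and> \<phi> (double_parabola s) = double_parabola (\<sigma> s)"
proof -
  obtain U V where "0 \<in> U" and d: "diffeo_between U V \<phi>"
    and im: "\<phi> ` (swallowtail \<inter> U) = swallowtail \<inter> V"
    using assms(1) by (auto simp: R_swallowtail_def)
  have U: "open U" and sm: "smooth_on U \<phi>"
    using d by (auto simp: diffeo_between_def)
  have ex: "\<exists>r. 0 < r \<and> \<phi> (double_parabola s) = double_parabola r"
    if s: "0 < s" "double_parabola s \<in> U" for s
  proof -
    define p where "p = double_parabola s"
    have "p \<in> U" and p: "p \<in> swallowtail"
      using s double_parabola_in_swallowtail by (simp_all add: p_def)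
    obtain \<Phi> where \<Phi>: "(\<phi> has_derivative \<Phi>) (at p)"
      using smooth_on_differentiable[OF sm \<open>p \<in> U\<close>] by (auto simp: differentiable_def)
    obtain \<Psi> where \<Psi>: "\<Phi> \<circ> \<Psi> = id"
      using diffeo_between_derivative[OF d \<open>p \<in> U\<close> \<Phi>] by blast
    \<comment> \<open>Only zero is conormal at \<open>p\<close>; surjectivity of
      \<open>\<Phi>\<close> carries this over to \<open>\<phi> p\<close>.\<close>
    have "L = (\<lambda>_. 0)" if "conormal swallowtail (\<phi> p) L" for L
    proof -
      have "conormal swallowtail p (L \<circ> \<Phi>)"
        using im by (intro conormal_pullback[OF U \<open>p \<in> U\<close> \<Phi> _ that]) auto
      then have "L \<circ> \<Phi> = (\<lambda>_. 0)"
        using conormal_double_parabola s(1) by (simp add: p_def)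
      then have "L \<circ> (\<Phi> \<circ> \<Psi>) = (\<lambda>_. 0)"
        unfolding comp_assoc[symmetric] by (simp add: o_def)
      then show ?thesis
        by (simp add: \<Psi>)
    qed
    moreover have "\<phi> p \<in> swallowtail"
      using im \<open>p \<in> U\<close> p by blast
    ultimately show ?thesis
      using double_parabola_if_no_conormal[of "\<phi> p"] unfolding p_def by metis
  qed
  have "\<forall>\<^sub>F s in at_right 0. double_parabola s \<in> U"
    using eventually_double_parabola[OF U \<open>0 \<in> U\<close>] by (simp add: eventually_nhds_conv_at eventually_at_split)
  moreover have "\<forall>\<^sub>F s::real in at_right 0. 0 < s"
    by (rule eventually_at_right_less)
  ultimately have "\<forall>\<^sub>F s in at_right 0. \<exists>r. 0 < r \<and> \<phi> (double_parabola s) = double_parabola r"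
    by eventually_elim (rule ex)
  \<comment> \<open>The parameter is chosen for each \<open>s\<close> separately; its behaviour near
    0 is derived afterwards from the derivative of \<open>\<phi>\<close>.\<close>
  then have "\<forall>\<^sub>F s in at_right 0. 0 < (SOME r. 0 < r \<and> \<phi> (double_parabola s) = double_parabola r)
      \<and> \<phi> (double_parabola s) = double_parabola (SOME r. 0 < r \<and> \<phi> (double_parabola s) = double_parabola r)"
    by eventually_elim (rule someI_ex)
  then show thesis
    by (rule that)
qed

text \<open>Both sides of the equation for \<open>\<sigma>\<close> are compared to first order at 0.
  The first component makes \<open>\<sigma> s / s\<close> converge, the second is 0, and the third
  is \<open>(\<sigma> s / s)^2 * s\<close> after division by \<open>s\<close>, so it tends to 0. The
  limit is nonnegative because \<open>\<sigma>\<close> is positive, and nonzero because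
  \<open>\<Phi>\<close> is injective.\<close>

lemma double_parabola_reparametrisation:
  assumes "\<phi> 0 = 0" "(\<phi> has_derivative \<Phi>) (at 0)" "inj \<Phi>"
    and \<sigma>: "\<forall>\<^sub>F s in at_right 0. 0 < \<sigma> s \<and> \<phi> (double_parabola s) = double_parabola (\<sigma> s)"
  obtains c where "0 < c" "\<Phi> (axis 1 1) = c *\<^sub>R axis 1 1" "((\<lambda>s. \<sigma> s / s) \<longlongrightarrow> c) (at_right 0)"
proof -
  have \<Phi>: "linear \<Phi>"
    using assms(2) by (rule has_derivative_linear)
  have d: "((\<lambda>s. \<phi> (double_parabola s)) has_vector_derivative (-2) *\<^sub>R \<Phi> (axis 1 1)) (at 0)"
  proof -
    have "(\<phi> has_derivative \<Phi>) (at (double_parabola 0))"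
      using assms(2) by simp
    from diff_chain_at[OF has_vector_derivative_double_parabola[of 0, unfolded has_vector_derivative_def] this]
    show ?thesis
      by (simp add: has_vector_derivative_def o_def linear_scale[OF \<Phi>] linear_neg[OF \<Phi>])
  qed
  define c where "c = \<Phi> (axis 1 1) $ 1"
  have comp: "((\<lambda>s. (1 / s) * double_parabola (\<sigma> s) $ i) \<longlongrightarrow> -2 * \<Phi> (axis 1 1) $ i) (at_right 0)" for i
  proof -
    have "((\<lambda>s. \<phi> (double_parabola s) $ i) has_vector_derivative ((-2) *\<^sub>R \<Phi> (axis 1 1)) $ i) (at 0)"
      by (rule bounded_linear.has_vector_derivative[OF bounded_linear_vec_nth d])
    then have "((\<lambda>s. (1 / s) * \<phi> (double_parabola s) $ i) \<longlongrightarrow> -2 * \<Phi> (axis 1 1) $ i) (at 0)"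
      unfolding has_real_derivative_iff_has_vector_derivative[symmetric] DERIV_def
      by (simp add: assms(1) field_simps)
    then have "((\<lambda>s. (1 / s) * \<phi> (double_parabola s) $ i) \<longlongrightarrow> -2 * \<Phi> (axis 1 1) $ i) (at_right 0)"
      by (simp add: filterlim_at_split)
    then show ?thesis
      by (rule Lim_transform_eventually) (use \<sigma> in eventually_elim, simp)
  qed
  have "((\<lambda>s. - 1 / 2 * ((1 / s) * double_parabola (\<sigma> s) $ 1)) \<longlongrightarrow> - 1 / 2 * (-2 * c)) (at_right 0)"
    unfolding c_def by (intro tendsto_mult_left comp)
  then have lim: "((\<lambda>s. \<sigma> s / s) \<longlongrightarrow> c) (at_right 0)"
    by (simp add: double_parabola_def)
  have "((\<lambda>s. 0) \<longlongrightarrow> -2 * \<Phi> (axis 1 1) $ 2) (at_right (0::real))"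
    using comp[of 2] by (simp add: double_parabola_def)
  then have 2: "\<Phi> (axis 1 1) $ 2 = 0"
    using tendsto_unique[OF trivial_limit_at_right_real _ tendsto_const] by fastforce
  have "((\<lambda>s. (\<sigma> s / s) * (\<sigma> s / s) * s) \<longlongrightarrow> c * c * 0) (at_right 0)"
    by (intro tendsto_mult lim tendsto_ident_at)
  moreover have "\<forall>\<^sub>F s in at_right 0. (\<sigma> s / s) * (\<sigma> s / s) * s = (1 / s) * double_parabola (\<sigma> s) $ 3"
    using eventually_at_right_less[of 0]
    by eventually_elim (simp add: double_parabola_def power2_eq_square)
  ultimately have "((\<lambda>s. (1 / s) * double_parabola (\<sigma> s) $ 3) \<longlongrightarrow> c * c * 0) (at_right 0)"
    by (rule Lim_transform_eventually)
  then have "-2 * \<Phi> (axis 1 1) $ 3 = c * c * 0"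
    using comp[of 3] tendsto_unique[OF trivial_limit_at_right_real] by blast
  with 2 have \<Phi>1: "\<Phi> (axis 1 1) = c *\<^sub>R axis 1 1"
    by (simp add: vec_eq_iff forall_3 c_def axis_def)
  have "\<forall>\<^sub>F s in at_right 0. 0 \<le> \<sigma> s / s"
    using \<sigma> eventually_at_right_less[of 0] by eventually_elim simp
  then have "0 \<le> c"
    using tendsto_lowerbound[OF lim] by simp
  moreover have "c \<noteq> 0"
  proof
    assume "c = 0"
    then have "\<Phi> (axis 1 1) = \<Phi> 0"
      using \<Phi>1 linear_0[OF \<Phi>] by simp
    then show False
      using assms(3) by (simp add: inj_eq)
  qed
  ultimately have "0 < c" by simp
  then show thesis
    using \<Phi>1 lim by (rule that)
qed

section \<open>Second order expansions along the double point curve\<close>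

lemma second_order_quotient:
  fixes k :: "real \<Rightarrow> real"
  assumes "\<forall>\<^sub>F s in nhds 0. (k has_real_derivative k1 s) (at s)"
    and "(k1 has_real_derivative k2) (at 0)" "k 0 = 0" "k1 0 = 0"
  shows "((\<lambda>s. k s / s^2) \<longlongrightarrow> k2 / 2) (at 0)"
proof (rule lhopital)
  have "(k has_real_derivative k1 0) (at 0)"
    using assms(1) by (rule eventually_nhds_x_imp_x)
  then have "isCont k 0"
    by (rule DERIV_isCont)
  then show "(k \<longlongrightarrow> 0) (at 0)"
    using assms(3) by (simp add: isCont_def)
  have "((\<lambda>s::real. s^2) \<longlongrightarrow> 0^2) (at 0)"
    by (intro tendsto_intros)
  then show "((\<lambda>s::real. s^2) \<longlongrightarrow> 0) (at 0)"
    by simp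
  show "\<forall>\<^sub>F s::real in at 0. s^2 \<noteq> 0" "\<forall>\<^sub>F s::real in at 0. 2 * s \<noteq> 0"
    by (simp_all add: eventually_at_filter)
  show "\<forall>\<^sub>F s in at 0. (k has_real_derivative k1 s) (at s)"
    using assms(1) by (simp add: eventually_nhds_conv_at)
  show "\<forall>\<^sub>F s::real in at 0. ((\<lambda>s. s^2) has_real_derivative 2 * s) (at s)"
    by (intro always_eventually allI) (auto intro!: derivative_eq_intros)
  \<comment> \<open>After one application of l'Hopital's rule what remains is half the difference
    quotient of \<open>k1\<close> at 0.\<close>
  have "((\<lambda>s. k1 s / s / 2) \<longlongrightarrow> k2 / 2) (at 0)"
    using assms(2,4) by (intro tendsto_divide tendsto_const) (auto simp: DERIV_def)
  then show "((\<lambda>s. k1 s / (2 * s)) \<longlongrightarrow> k2 / 2) (at 0)"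
    by (simp add: mult.commute)
qed

text \<open>Two levels of \<open>Ck_on\<close> are unfolded. Since that predicate iterates
  directional derivatives, the second derivative appears separately for each fixed direction
  \<open>v\<close>.\<close>

lemma smooth_on_second_order:
  assumes "smooth_on U f"
  obtains G where
    "\<And>v x. x \<in> U \<Longrightarrow> ((\<lambda>x. frechet_derivative f (at x) v) has_derivative G v x) (at x)"
    "\<And>v w. continuous_on U (\<lambda>x. G v x w)"
proof
  have 2: "Ck_on (Suc (Suc 0)) U f"
    using assms unfolding smooth_on_def by blast
  fix v
  show "((\<lambda>x. frechet_derivative f (at x) v) has_derivative
      frechet_derivative (\<lambda>x. frechet_derivative f (at x) v) (at x)) (at x)" if "x \<in> U" for x
    using 2 that by (simp flip: frechet_derivative_works)
  show "continuous_on U (\<lambda>x. frechet_derivative (\<lambda>x. frechet_derivative f (at x) v) (at x) w)" for w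
    using 2 by simp
qed

text \<open>The first two derivatives of the regularly parametrised curve serve both for the order
  of the height function along it and for its osculating planes.\<close>

lemma smooth_double_parabola_second_order:
  fixes \<psi> :: "real^3 \<Rightarrow> 'b::real_normed_vector"
  assumes "smooth_on U \<psi>" "open U" "0 \<in> U"
  obtains C1 C2 where
    "\<forall>\<^sub>F s in nhds 0. ((\<psi> \<circ> double_parabola) has_vector_derivative C1 s) (at s)"
    "\<forall>\<^sub>F s in nhds 0. (C1 has_vector_derivative C2 s) (at s)"
    "isCont C1 0" "isCont C2 0" "C1 0 = (-2) *\<^sub>R frechet_derivative \<psi> (at 0) (axis 1 1)"
proof -
  define E where "E v x = frechet_derivative \<psi> (at x) v" for v x
  obtain G where G: "\<And>v x. x \<in> U \<Longrightarrow> (E v has_derivative G v x) (at x)"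
    "\<And>v w. continuous_on U (\<lambda>x. G v x w)"
    using smooth_on_second_order[OF assms(1)] unfolding E_def by metis
  have chain: "((h \<circ> double_parabola) has_vector_derivative
      (-2) *\<^sub>R D (axis 1 1) + (2 * s) *\<^sub>R D (axis 3 1)) (at s)"
    if D: "(h has_derivative D) (at (double_parabola s))" for h :: "real^3 \<Rightarrow> 'b" and D s
  proof -
    have "linear D"
      using D by (rule has_derivative_linear)
    have "((h \<circ> double_parabola) has_derivative D \<circ> (\<lambda>x. x *\<^sub>R ((-2) *\<^sub>R axis 1 1 + (2 * s) *\<^sub>R axis 3 1))) (at s)"
      using has_vector_derivative_double_parabola[of s] D
      unfolding has_vector_derivative_def by (rule diff_chain_at)
    then show ?thesis
      unfolding has_vector_derivative_def o_def linear_scale[OF \<open>linear D\<close>] linear_add[OF \<open>linear D\<close>] .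
  qed
  \<comment> \<open>Chain rule for the velocity \<open>(-2, 0, 2 * s)\<close>; the last term of
    \<open>C2\<close> below arises from differentiating the factor \<open>2 * s\<close>.\<close>
  define C1 where "C1 s = (-2) *\<^sub>R E (axis 1 1) (double_parabola s)
    + (2 * s) *\<^sub>R E (axis 3 1) (double_parabola s)" for s
  define H where "H v s = (-2) *\<^sub>R G v (double_parabola s) (axis 1 1)
    + (2 * s) *\<^sub>R G v (double_parabola s) (axis 3 1)" for v s
  define C2 where "C2 s = (-2) *\<^sub>R H (axis 1 1) s
    + ((2 * s) *\<^sub>R H (axis 3 1) s + 2 *\<^sub>R E (axis 3 1) (double_parabola s))" for s
  have U: "\<forall>\<^sub>F s in nhds 0. double_parabola s \<in> U"
    using assms(2,3) by (rule eventually_double_parabola)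
  have \<psi>: "(\<psi> has_derivative (\<lambda>v. E v x)) (at x)" if "x \<in> U" for x
    using smooth_on_differentiable[OF assms(1) that]
    by (simp add: E_def frechet_derivative_works)
  have EB: "((\<lambda>s. E v (double_parabola s)) has_vector_derivative H v s) (at s)"
    if "double_parabola s \<in> U" for v s
    using chain[OF G(1)[OF that, of v]] by (simp add: H_def o_def)
  have C2: "(C1 has_vector_derivative C2 s) (at s)" if "double_parabola s \<in> U" for s
    unfolding C1_def C2_def
    by (rule derivative_eq_intros EB[OF that] refl | simp)+
  have cont: "isCont (\<lambda>s. G v (double_parabola s) w) 0" for v w
    using G(2)[of v w] assms(2,3) isCont_double_parabola[of 0]
    by (intro isCont_o2[where g = "\<lambda>x. G v x w" and f = double_parabola])
      (auto simp: continuous_on_eq_continuous_at)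
  show thesis
  proof
    show "\<forall>\<^sub>F s in nhds 0. ((\<psi> \<circ> double_parabola) has_vector_derivative C1 s) (at s)"
      using U by eventually_elim (unfold C1_def, intro chain \<psi>)
    show "\<forall>\<^sub>F s in nhds 0. (C1 has_vector_derivative C2 s) (at s)"
      using U by eventually_elim (rule C2)
    show "isCont C1 0"
      using C2[of 0] assms(3) has_vector_derivative_continuous by simp blast
    have "isCont (H v) 0" for v
      unfolding H_def by (intro continuous_intros cont)
    moreover have "isCont (\<lambda>s. E v (double_parabola s)) 0" for v
      using EB[of 0 v] assms(3) has_vector_derivative_continuous by simp blast
    ultimately show "isCont C2 0"
      unfolding C2_def by (intro continuous_intros)
    show "C1 0 = (-2) *\<^sub>R frechet_derivative \<psi> (at 0) (axis 1 1)"
      by (simp add: C1_def E_def)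
  qed
qed

subsection \<open>Limiting tangent lines and osculating planes\<close>

lemma span_singleton_scaleR:
  fixes v :: "'a::real_vector"
  shows "k \<noteq> 0 \<Longrightarrow> span {k *\<^sub>R v} = span {v}"
  by (rule span_image_scale[of "{v}" "\<lambda>_. k", simplified])

text \<open>The scalar \<open>r\<close> absorbs the zero of the velocity at \<open>t = 0\<close>,
  leaving a direction \<open>D\<close> with nonzero limit.\<close>

lemma limiting_tangent_line_iff:
  assumes "\<forall>\<^sub>F t in at 0. vector_derivative \<gamma> (at t) = r t *\<^sub>R D t \<and> r t \<noteq> 0"
    and D: "(D \<longlongrightarrow> D0) (at 0)" "D0 \<noteq> 0"
  shows "limiting_tangent_line \<gamma> L \<longleftrightarrow> L = span {D0}"
proof -
  have span_sgn: "span {sgn v} = span {v}" for v :: "real^3"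
    by (cases "v = 0") (simp_all add: sgn_div_norm span_singleton_scaleR)
  have lim: "((\<lambda>t. sgn (D t)) \<longlongrightarrow> sgn D0) (at 0)"
    using D by (rule tendsto_sgn)
  have "\<forall>\<^sub>F t in at 0. D t \<noteq> 0"
    using D by (rule tendsto_imp_eventually_ne)
  with assms(1) have ev: "\<forall>\<^sub>F t in at 0. norm (sgn (D t)) = 1 \<and>
      span {vector_derivative \<gamma> (at t)} = span {sgn (D t)}"
    by eventually_elim (simp add: span_singleton_scaleR span_sgn norm_sgn)
  show ?thesis
  proof
    assume "L = span {D0}"
    then show "limiting_tangent_line \<gamma> L"
      unfolding limiting_tangent_line_def
      by (intro exI[of _ "\<lambda>t. sgn (D t)"] exI[of _ "sgn D0"] conjI ev lim) (simp add: span_sgn)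
  next
    assume "limiting_tangent_line \<gamma> L"
    then obtain d d0 where d: "\<forall>\<^sub>F t in at 0. norm (d t) = 1 \<and> span {vector_derivative \<gamma> (at t)} = span {d t}"
      "(d \<longlongrightarrow> d0) (at 0)" and L: "L = span {d0}"
      unfolding limiting_tangent_line_def by blast
    \<comment> \<open>A unit vector \<open>d t\<close> equals \<open>sgn (D t)\<close> only up to a
      sign that could depend on \<open>t\<close>. Writing it as its own projection gives an identity
      that passes to the limit.\<close>
    from d(1) ev have "\<forall>\<^sub>F t in at 0. d t = (d t \<bullet> sgn (D t)) *\<^sub>R sgn (D t)"
    proof eventually_elim
      case (elim t)
      then have "d t \<in> span {sgn (D t)}"
        using span_base[of "d t" "{d t}"] by simp
      then obtain k where "d t = k *\<^sub>R sgn (D t)"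
        by (auto simp: span_singleton)
      then show ?case
        using elim by (simp add: dot_square_norm)
    qed
    moreover have "((\<lambda>t. (d t \<bullet> sgn (D t)) *\<^sub>R sgn (D t)) \<longlongrightarrow> (d0 \<bullet> sgn D0) *\<^sub>R sgn D0) (at 0)"
      by (intro tendsto_intros d(2) lim)
    ultimately have "(d \<longlongrightarrow> (d0 \<bullet> sgn D0) *\<^sub>R sgn D0) (at 0)"
      by (metis (mono_tags, lifting) Lim_transform_eventually eventually_mono)
    then have d0: "d0 = (d0 \<bullet> sgn D0) *\<^sub>R sgn D0"
      using d(2) by (intro tendsto_unique[of "at (0::real)" d]) auto
    have "((\<lambda>t. norm (d t)) \<longlongrightarrow> norm d0) (at 0)"
      using d(2) by (rule tendsto_norm)
    moreover have "((\<lambda>t. norm (d t)) \<longlongrightarrow> 1) (at 0)"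
      by (rule tendsto_eventually) (use d(1) in eventually_elim, simp)
    ultimately have "norm d0 = 1"
      by (intro tendsto_unique[of "at (0::real)"]) auto
    then have "d0 \<bullet> sgn D0 \<noteq> 0"
      using d0 by auto
    then show "L = span {D0}"
      unfolding L by (subst d0) (simp add: span_singleton_scaleR span_sgn)
  qed
qed

lemma span_pair_eq_hyperplane:
  assumes "cross3 x y \<noteq> 0"
  shows "span {x, y} = {p. p \<bullet> cross3 x y = 0}"
proof (rule subspace_dim_equal)
  show "subspace (span {x, y})" "subspace {p. p \<bullet> cross3 x y = 0}"
    by (simp_all add: subspace_hyperplane2)
  show "span {x, y} \<subseteq> {p. p \<bullet> cross3 x y = 0}"
    by (rule span_minimal) (auto simp: subspace_hyperplane2 dot_cross_self)
  have "x \<notin> span {y}"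
    using assms by (auto simp: span_singleton cross_mult_left)
  moreover have "y \<noteq> 0"
    using assms by auto
  ultimately have "independent {x, y}" and "x \<noteq> y"
    using span_base[of y "{y}"] by (auto simp: independent_insert)
  then have "dim (span {x, y}) = 2"
    by (simp add: dim_eq_card_independent)
  moreover have "dim {p. p \<bullet> cross3 x y = 0} = 2"
    using dim_hyperplane[OF assms] by (simp add: inner_commute)
  ultimately show "dim {p. p \<bullet> cross3 x y = 0} \<le> dim (span {x, y})"
    by simp
qed

lemma square_curve_derivatives:
  fixes C :: "real \<Rightarrow> 'a::real_normed_vector"
  assumes C1: "\<forall>\<^sub>F s in nhds 0. (C has_vector_derivative C1 s) (at s)"
    and C2: "\<forall>\<^sub>F s in nhds 0. (C1 has_vector_derivative C2 s) (at s)"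
  shows "\<forall>\<^sub>F t in at 0. vector_derivative (\<lambda>t. C (t^2)) (at t) = (2 * t) *\<^sub>R C1 (t^2)"
    and "\<forall>\<^sub>F t in at 0. vector_derivative (\<lambda>s. vector_derivative (\<lambda>t. C (t^2)) (at s)) (at t)
      = 2 *\<^sub>R C1 (t^2) + (4 * t^2) *\<^sub>R C2 (t^2)"
proof -
  have sq: "filterlim (\<lambda>t::real. t^2) (nhds 0) (nhds 0)"
  proof -
    have "((\<lambda>t::real. t^2) \<longlongrightarrow> 0^2) (nhds 0)"
      by (intro tendsto_intros filterlim_ident)
    then show ?thesis by simp
  qed
  have chain: "((\<lambda>t. h (t^2)) has_vector_derivative (2 * t) *\<^sub>R d) (at t)"
    if "(h has_vector_derivative d) (at (t^2))" for h :: "real \<Rightarrow> 'a" and d t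
  proof -
    have "((\<lambda>t. t^2) has_vector_derivative 2 * t) (at t)"
      by (auto intro!: derivative_eq_intros simp flip: has_real_derivative_iff_has_vector_derivative)
    from vector_diff_chain_at[OF this that] show ?thesis
      by (simp add: o_def)
  qed
  have "\<forall>\<^sub>F t in nhds 0. (C has_vector_derivative C1 (t^2)) (at (t^2))"
    using C1 sq by (rule eventually_compose_filterlim)
  then have 1: "\<forall>\<^sub>F t in nhds 0. vector_derivative (\<lambda>t. C (t^2)) (at t) = (2 * t) *\<^sub>R C1 (t^2)"
    by eventually_elim (rule vector_derivative_at[OF chain])
  then show "\<forall>\<^sub>F t in at 0. vector_derivative (\<lambda>t. C (t^2)) (at t) = (2 * t) *\<^sub>R C1 (t^2)"
    by (simp add: eventually_nhds_conv_at)
  have "\<forall>\<^sub>F t in nhds 0. (C1 has_vector_derivative C2 (t^2)) (at (t^2))"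
    using C2 sq by (rule eventually_compose_filterlim)
  \<comment> \<open>Differentiating the first derivative at \<open>t\<close> requires its formula on
    a whole neighbourhood of \<open>t\<close>.\<close>
  moreover have "\<forall>\<^sub>F t in nhds 0. \<forall>\<^sub>F s in nhds t.
      vector_derivative (\<lambda>t. C (t^2)) (at s) = (2 * s) *\<^sub>R C1 (s^2)"
    using 1 by (simp add: eventually_eventually)
  ultimately have "\<forall>\<^sub>F t in nhds 0.
      vector_derivative (\<lambda>s. vector_derivative (\<lambda>t. C (t^2)) (at s)) (at t)
      = 2 *\<^sub>R C1 (t^2) + (4 * t^2) *\<^sub>R C2 (t^2)"
  proof eventually_elim
    case (elim t)
    have *: "((\<lambda>s. (2 * s) *\<^sub>R C1 (s^2)) has_vector_derivative
        (2 * t) *\<^sub>R ((2 * t) *\<^sub>R C2 (t^2)) + 2 *\<^sub>R C1 (t^2)) (at t)"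
    proof (rule has_vector_derivative_scaleR)
      show "((\<lambda>s. 2 * s) has_real_derivative 2) (at t)"
        by (auto intro!: derivative_eq_intros)
      show "((\<lambda>s. C1 (s^2)) has_vector_derivative (2 * t) *\<^sub>R C2 (t^2)) (at t)"
        using elim(1) by (rule chain)
    qed
    obtain S where S: "open S" "t \<in> S"
      "\<forall>s\<in>S. vector_derivative (\<lambda>t. C (t^2)) (at s) = (2 * s) *\<^sub>R C1 (s^2)"
      using elim(2)[unfolded eventually_nhds] by (elim exE conjE)
    have "((\<lambda>s. vector_derivative (\<lambda>t. C (t^2)) (at s)) has_vector_derivative
        (2 * t) *\<^sub>R ((2 * t) *\<^sub>R C2 (t^2)) + 2 *\<^sub>R C1 (t^2)) (at t)"
      using * S(1,2)
      by (rule has_vector_derivative_transform_within_open) (rule S(3)[rule_format, symmetric])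
    then show ?case
      by (simp add: vector_derivative_at power2_eq_square)
  qed
  then show "\<forall>\<^sub>F t in at 0. vector_derivative (\<lambda>s. vector_derivative (\<lambda>t. C (t^2)) (at s)) (at t)
      = 2 *\<^sub>R C1 (t^2) + (4 * t^2) *\<^sub>R C2 (t^2)"
    by (simp add: eventually_nhds_conv_at)
qed

text \<open>The first two derivatives of \<open>C (t^2)\<close> have cross product
  \<open>8 * t^3\<close> times that of \<open>C1\<close> and \<open>C2\<close> at
  \<open>t^2\<close>. The scalar does not affect the plane, so the normals can be taken continuous
  through \<open>t = 0\<close>.\<close>

lemma limiting_osculating_plane_square:
  fixes C :: "real \<Rightarrow> real^3"
  assumes C1: "\<forall>\<^sub>F s in nhds 0. (C has_vector_derivative C1 s) (at s)"
    and C2: "\<forall>\<^sub>F s in nhds 0. (C1 has_vector_derivative C2 s) (at s)"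
    and "isCont C1 0" "isCont C2 0" and N: "cross3 (C1 0) (C2 0) \<noteq> 0"
  shows "limiting_osculating_plane (\<lambda>t. C (t^2)) {p. p \<bullet> cross3 (C1 0) (C2 0) = 0}"
proof -
  define N where "N t = cross3 (C1 (t^2)) (C2 (t^2))" for t
  have "isCont (\<lambda>t. f (t^2)) 0" if "isCont f 0" for f :: "real \<Rightarrow> real^3"
    using that by (intro isCont_o2[where g = f and f = "\<lambda>t. t^2"]) (auto intro!: continuous_intros)
  then have "isCont N 0"
    unfolding N_def using assms(3,4) by (intro continuous_cross) auto
  then have lim: "(N \<longlongrightarrow> N 0) (at 0)"
    by (simp add: isCont_def)
  have N0: "N 0 = cross3 (C1 0) (C2 0)"
    by (simp add: N_def)
  have hyper: "{p. p \<bullet> (k *\<^sub>R v) = 0} = {p. p \<bullet> v = 0}" if "k \<noteq> 0" for k and v :: "real^3"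
    using that by simp
  have sgn: "{p. p \<bullet> sgn v = 0} = {p. p \<bullet> v = 0}" if "v \<noteq> 0" for v :: "real^3"
    using that by (simp add: sgn_div_norm)
  have "\<forall>\<^sub>F t in at 0. N t \<noteq> 0"
    using lim N N0 by (intro tendsto_imp_eventually_ne) auto
  moreover have "\<forall>\<^sub>F t::real in at 0. t \<noteq> 0"
    by (simp add: eventually_at_filter)
  moreover note square_curve_derivatives[OF C1 C2]
  ultimately have "\<forall>\<^sub>F t in at 0. norm (sgn (N t)) = 1 \<and>
      span {vector_derivative (\<lambda>t. C (t^2)) (at t),
        vector_derivative (\<lambda>s. vector_derivative (\<lambda>t. C (t^2)) (at s)) (at t)}
      = {p. p \<bullet> sgn (N t) = 0}"
  proof eventually_elim
    case (elim t)
    have "cross3 ((2 * t) *\<^sub>R C1 (t^2)) (2 *\<^sub>R C1 (t^2) + (4 * t^2) *\<^sub>R C2 (t^2)) = (8 * t^3) *\<^sub>R N t"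
      by (simp add: N_def cross_mult_left cross_mult_right cross_add_right power_numeral_reduce)
    then show ?case
      using elim span_pair_eq_hyperplane[of "(2 * t) *\<^sub>R C1 (t^2)"
          "2 *\<^sub>R C1 (t^2) + (4 * t^2) *\<^sub>R C2 (t^2)"]
      by (simp add: hyper sgn norm_sgn)
  qed
  moreover have "((\<lambda>t. sgn (N t)) \<longlongrightarrow> sgn (N 0)) (at 0)"
    using lim N N0 by (intro tendsto_sgn) auto
  moreover have "{p. p \<bullet> cross3 (C1 0) (C2 0) = 0} = {p. p \<bullet> sgn (N 0) = 0}"
    using sgn[OF N] by (simp add: N0)
  ultimately show ?thesis
    unfolding limiting_osculating_plane_def
    by (intro exI[of _ "\<lambda>t. sgn (N t)"] exI[of _ "sgn (N 0)"] conjI)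
qed

subsection \<open>Height functions and normal forms\<close>

lemma normal_form_derivative:
  "g \<in> normal_form_u \<Longrightarrow> \<exists>s\<in>{1, -1}. (g has_derivative (\<lambda>\<xi>. s * \<xi>$1)) (at 0)"
  "g \<in> normal_form_vu2 \<Longrightarrow> (g has_derivative (\<lambda>\<xi>. \<xi>$2)) (at 0)"
  "g \<in> normal_form_vu3 \<Longrightarrow> (g has_derivative (\<lambda>\<xi>. \<xi>$2)) (at 0)"
  "g \<in> normal_form_w \<Longrightarrow> \<exists>s\<in>{1, -1}. (g has_derivative (\<lambda>\<xi>. s * \<xi>$3)) (at 0)"
proof -
  have nth: "((\<lambda>p::real^3. p$i) has_derivative (\<lambda>\<xi>. \<xi>$i)) (at 0)" for i
    by (rule bounded_linear.has_derivative[OF bounded_linear_vec_nth has_derivative_ident])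
  have "((\<lambda>p::real^3. s * p$1) has_derivative (\<lambda>\<xi>. s * \<xi>$1)) (at 0)" for s
    by (rule derivative_eq_intros nth refl | simp)+
  then show "g \<in> normal_form_u \<Longrightarrow> \<exists>s\<in>{1, -1}. (g has_derivative (\<lambda>\<xi>. s * \<xi>$1)) (at 0)"
    unfolding normal_form_u_def by blast
  have "((\<lambda>p::real^3. p$2 + a * (p$1)^2) has_derivative (\<lambda>\<xi>. \<xi>$2)) (at 0)" for a
    by (rule derivative_eq_intros nth refl | simp)+
  then show "g \<in> normal_form_vu2 \<Longrightarrow> (g has_derivative (\<lambda>\<xi>. \<xi>$2)) (at 0)"
    unfolding normal_form_vu2_def by blast
  have "((\<lambda>p::real^3. p$2 + a * (p$1)^3) has_derivative (\<lambda>\<xi>. \<xi>$2)) (at 0)" for a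
    by (rule derivative_eq_intros nth refl | simp)+
  then show "g \<in> normal_form_vu3 \<Longrightarrow> (g has_derivative (\<lambda>\<xi>. \<xi>$2)) (at 0)"
    unfolding normal_form_vu3_def by blast
  have "((\<lambda>p::real^3. s * p$3 + a * (p$1)^2 + b * (p$1)^3) has_derivative (\<lambda>\<xi>. s * \<xi>$3)) (at 0)"
    for s a b
    by (rule derivative_eq_intros nth refl | simp)+
  then show "g \<in> normal_form_w \<Longrightarrow> \<exists>s\<in>{1, -1}. (g has_derivative (\<lambda>\<xi>. s * \<xi>$3)) (at 0)"
    unfolding normal_form_w_def by blast
qed

text \<open>Along \<open>(-2 * s, 0, s^2)\<close> the third form equals \<open>-8 * a * s^3\<close>.
  The fourth has \<open>s^2\<close>-coefficient \<open>e + 4 * a\<close>, nonzero because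
  \<open>a\<close> differs from 1/4 and -1/4.\<close>

lemma normal_form_double_parabola:
  "g \<in> normal_form_vu3 \<Longrightarrow> ((\<lambda>s. g (double_parabola s) / s^2) \<longlongrightarrow> 0) (at_right 0)"
  "g \<in> normal_form_w \<Longrightarrow> \<exists>k. k \<noteq> 0 \<and> ((\<lambda>s. g (double_parabola s) / s^2) \<longlongrightarrow> k) (at_right 0)"
proof -
  have pos: "\<forall>\<^sub>F s::real in at_right 0. 0 < s"
    by (rule eventually_at_right_less)
  assume "g \<in> normal_form_vu3"
  then obtain a where g: "g = (\<lambda>p. p$2 + a * (p$1)^3)"
    by (auto simp: normal_form_vu3_def)
  have "((\<lambda>s. -8 * a * s) \<longlongrightarrow> -8 * a * 0) (at_right 0)"
    by (intro tendsto_intros)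
  moreover have "\<forall>\<^sub>F s in at_right 0. -8 * a * s = g (double_parabola s) / s^2"
    using pos by eventually_elim (simp add: g double_parabola_def power_numeral_reduce field_simps)
  ultimately have "((\<lambda>s. g (double_parabola s) / s^2) \<longlongrightarrow> -8 * a * 0) (at_right 0)"
    by (rule Lim_transform_eventually)
  then show "((\<lambda>s. g (double_parabola s) / s^2) \<longlongrightarrow> 0) (at_right 0)"
    by simp
next
  have pos: "\<forall>\<^sub>F s::real in at_right 0. 0 < s"
    by (rule eventually_at_right_less)
  assume "g \<in> normal_form_w"
  then obtain e a b where g: "g = (\<lambda>p. e * p$3 + a * (p$1)^2 + b * (p$1)^3)"
    and e: "e \<in> {1, -1}" "a \<notin> {0, 1/12, -1/12, 1/4, -1/4}"
    unfolding normal_form_w_def by blast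
  have "((\<lambda>s. e + 4 * a - 8 * b * s) \<longlongrightarrow> e + 4 * a - 8 * b * 0) (at_right 0)"
    by (intro tendsto_intros)
  moreover have "\<forall>\<^sub>F s in at_right 0. e + 4 * a - 8 * b * s = g (double_parabola s) / s^2"
    using pos by eventually_elim (simp add: g double_parabola_def power_numeral_reduce field_simps)
  ultimately have "((\<lambda>s. g (double_parabola s) / s^2) \<longlongrightarrow> e + 4 * a - 8 * b * 0) (at_right 0)"
    by (rule Lim_transform_eventually)
  moreover have "e + 4 * a - 8 * b * 0 \<noteq> 0"
    using e by auto
  ultimately show "\<exists>k. k \<noteq> 0 \<and> ((\<lambda>s. g (double_parabola s) / s^2) \<longlongrightarrow> k) (at_right 0)"
    by blast
qed

text \<open>Everything first order follows from \<open>D\<close> being the derivative of the height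
  function composed with \<open>\<Phi>\<close>. At second order, \<open>g\<close> along the double
  point curve is the height function along \<open>\<psi> \<circ> double_parabola\<close> at the
  parameter \<open>\<sigma> s\<close>.\<close>

lemma R_equivalent_height:
  assumes equiv: "R_equivalent (height \<nu> \<circ> \<psi>) g"
    and \<psi>: "\<psi> 0 = 0" "(\<psi> has_derivative A) (at 0)"
    and g: "(g has_derivative D) (at 0)"
    and C1: "\<forall>\<^sub>F s in nhds 0. ((\<psi> \<circ> double_parabola) has_vector_derivative C1 s) (at s)"
    and C2: "(C1 has_vector_derivative C2) (at 0)"
  shows "conormal swallowtail 0 D \<longleftrightarrow> conormal swallowtail 0 (\<lambda>\<xi>. A \<xi> \<bullet> \<nu>)"
    and "D (axis 1 1) = 0 \<longleftrightarrow> A (axis 1 1) \<bullet> \<nu> = 0"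
    and "C1 0 \<bullet> \<nu> = 0 \<Longrightarrow>
      \<exists>c>0. ((\<lambda>s. g (double_parabola s) / s^2) \<longlongrightarrow> c * (C2 \<bullet> \<nu>)) (at_right 0)"
proof -
  obtain \<phi> where \<phi>: "\<phi> \<in> R_swallowtail" and ev: "\<forall>\<^sub>F p in nhds 0. g p = (height \<nu> \<circ> \<psi>) (\<phi> p)"
    using equiv by (auto simp: R_equivalent_def)
  obtain U V where "\<phi> 0 = 0" "0 \<in> U" and d: "diffeo_between U V \<phi>"
    using \<phi> by (auto simp: R_swallowtail_def)
  have "smooth_on U \<phi>"
    using d by (simp add: diffeo_between_def)
  then obtain \<Phi> where \<Phi>: "(\<phi> has_derivative \<Phi>) (at 0)"
    using smooth_on_differentiable[OF _ \<open>0 \<in> U\<close>] unfolding differentiable_def by metis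
  have "inj \<Phi>"
    using diffeo_between_derivative[OF d \<open>0 \<in> U\<close> \<Phi>] by (metis inj_on_id inj_on_imageI2)
  have A: "linear A"
    using \<psi>(2) by (rule has_derivative_linear)
  have "((\<lambda>p. \<psi> (\<phi> p)) has_derivative (\<lambda>\<xi>. A (\<Phi> \<xi>))) (at 0)"
    using diff_chain_at[OF \<Phi>, of \<psi> A] \<psi>(2) \<open>\<phi> 0 = 0\<close> by (simp add: o_def)
  then have h: "((\<lambda>p. \<psi> (\<phi> p) \<bullet> \<nu>) has_derivative (\<lambda>\<xi>. A (\<Phi> \<xi>) \<bullet> \<nu>)) (at 0)"
    by (rule has_derivative_inner_left)
  obtain W where W: "open W" "0 \<in> W" "\<forall>p\<in>W. g p = \<psi> (\<phi> p) \<bullet> \<nu>"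
    using ev unfolding eventually_nhds by (auto simp: height_def)
  have "(g has_derivative (\<lambda>\<xi>. A (\<Phi> \<xi>) \<bullet> \<nu>)) (at 0)"
    by (rule has_derivative_transform_within_open[OF h W(1,2)]) (simp add: W(3))
  then have D: "D = (\<lambda>\<xi>. A \<xi> \<bullet> \<nu>) \<circ> \<Phi>"
    using has_derivative_unique[OF g] by (simp add: o_def)
  obtain \<sigma> where \<sigma>: "\<forall>\<^sub>F s in at_right 0. 0 < \<sigma> s \<and> \<phi> (double_parabola s) = double_parabola (\<sigma> s)"
    using R_swallowtail_double_parabola[OF \<phi>] .
  obtain c where c: "0 < c" "\<Phi> (axis 1 1) = c *\<^sub>R axis 1 1" "((\<lambda>s. \<sigma> s / s) \<longlongrightarrow> c) (at_right 0)"
    using double_parabola_reparametrisation[OF \<open>\<phi> 0 = 0\<close> \<Phi> \<open>inj \<Phi>\<close> \<sigma>] .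
  show "conormal swallowtail 0 D \<longleftrightarrow> conormal swallowtail 0 (\<lambda>\<xi>. A \<xi> \<bullet> \<nu>)"
    unfolding D using \<phi> \<Phi> by (rule R_swallowtail_conormal_0)
  show "D (axis 1 1) = 0 \<longleftrightarrow> A (axis 1 1) \<bullet> \<nu> = 0"
    using c(1) by (simp add: D c(2) linear_scale[OF A])
  assume C1\<nu>: "C1 0 \<bullet> \<nu> = 0"
  define k where "k s = \<psi> (double_parabola s) \<bullet> \<nu>" for s
  have inner: "((\<lambda>s. f s \<bullet> \<nu>) has_real_derivative f' \<bullet> \<nu>) (at s)"
    if "(f has_vector_derivative f') (at s)" for f :: "real \<Rightarrow> real^3" and f' s
    using bounded_linear.has_vector_derivative[OF bounded_linear_inner_left that, of \<nu>]
    by (simp add: has_real_derivative_iff_has_vector_derivative)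
  have "((\<lambda>s. k s / s^2) \<longlongrightarrow> (C2 \<bullet> \<nu>) / 2) (at 0)"
  proof (rule second_order_quotient)
    show "\<forall>\<^sub>F s in nhds 0. (k has_real_derivative C1 s \<bullet> \<nu>) (at s)"
      using C1 by eventually_elim (use inner in \<open>simp add: k_def[abs_def] o_def\<close>)
    show "((\<lambda>s. C1 s \<bullet> \<nu>) has_real_derivative C2 \<bullet> \<nu>) (at 0)"
      using C2 by (rule inner)
  qed (simp_all add: k_def \<psi>(1) C1\<nu>)
  moreover have "filterlim \<sigma> (at 0) (at_right 0)"
  proof (rule filterlim_atI)
    have "((\<lambda>s. \<sigma> s / s * s) \<longlongrightarrow> c * 0) (at_right 0)"
      by (intro tendsto_mult c(3) tendsto_ident_at)
    moreover have "\<forall>\<^sub>F s in at_right 0. \<sigma> s / s * s = \<sigma> s"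
      using eventually_at_right_less[of "0::real"] by eventually_elim simp
    ultimately have "(\<sigma> \<longlongrightarrow> c * 0) (at_right 0)"
      by (rule Lim_transform_eventually)
    then show "(\<sigma> \<longlongrightarrow> 0) (at_right 0)"
      by simp
    show "\<forall>\<^sub>F s in at_right 0. \<sigma> s \<noteq> 0"
      using \<sigma> by eventually_elim simp
  qed
  ultimately have "((\<lambda>s. k (\<sigma> s) / (\<sigma> s)^2) \<longlongrightarrow> (C2 \<bullet> \<nu>) / 2) (at_right 0)"
    by (rule filterlim_compose)
  \<comment> \<open>The change of parameter contributes the square of \<open>\<sigma> s / s\<close>,
    hence the constant \<open>c^2 / 2\<close>.\<close>
  then have "((\<lambda>s. k (\<sigma> s) / (\<sigma> s)^2 * (\<sigma> s / s)^2) \<longlongrightarrow> (C2 \<bullet> \<nu>) / 2 * c^2) (at_right 0)"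
    by (intro tendsto_mult tendsto_power c(3))
  moreover have "\<forall>\<^sub>F s in at_right 0. double_parabola s \<in> W"
    using eventually_double_parabola[OF W(1,2)]
    by (simp add: eventually_nhds_conv_at eventually_at_split)
  with \<sigma> have "\<forall>\<^sub>F s in at_right 0.
      k (\<sigma> s) / (\<sigma> s)^2 * (\<sigma> s / s)^2 = g (double_parabola s) / s^2"
    by eventually_elim (use W(3) in \<open>simp add: k_def power_divide\<close>)
  ultimately have "((\<lambda>s. g (double_parabola s) / s^2) \<longlongrightarrow> (C2 \<bullet> \<nu>) / 2 * c^2) (at_right 0)"
    by (rule Lim_transform_eventually)
  then have "((\<lambda>s. g (double_parabola s) / s^2) \<longlongrightarrow> c^2 / 2 * (C2 \<bullet> \<nu>)) (at_right 0)"
    by (simp add: mult.commute)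
  then show "\<exists>c>0. ((\<lambda>s. g (double_parabola s) / s^2) \<longlongrightarrow> c * (C2 \<bullet> \<nu>)) (at_right 0)"
    using c(1) by (intro exI[of _ "c^2 / 2"]) simp
qed

text \<open>Any vector splits into its projection to the plane along \<open>q\<close> and a multiple
  of \<open>q\<close>.\<close>

lemma transverse_hyperplane:
  assumes "q \<bullet> \<nu> \<noteq> 0" "\<And>k. k *\<^sub>R q \<in> Q"
  shows "transverse {p. height \<nu> p = 0} Q"
proof -
  have "\<exists>x y. z = x + y \<and> height \<nu> x = 0 \<and> y \<in> Q" for z
    by (intro exI[of _ "z - (z \<bullet> \<nu> / (q \<bullet> \<nu>)) *\<^sub>R q"] exI[of _ "(z \<bullet> \<nu> / (q \<bullet> \<nu>)) *\<^sub>R q"])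
      (simp add: assms height_def inner_diff_left)
  then show ?thesis
    unfolding transverse_def by auto
qed

text \<open>The velocity is \<open>2 * t\<close> times \<open>C1 (t^2)\<close>, and
  \<open>C1 0\<close> is a nonzero multiple of the image of the first axis.\<close>

lemma limiting_tangent_line_double_point_curve:
  assumes "smooth_on U \<psi>" "open U" "0 \<in> U" "frechet_derivative \<psi> (at 0) (axis 1 1) \<noteq> 0"
  shows "limiting_tangent_line (\<psi> \<circ> double_point_curve) L \<longleftrightarrow>
    L = span {frechet_derivative \<psi> (at 0) (axis 1 1)}"
proof -
  obtain C1 C2 where C:
    "\<forall>\<^sub>F s in nhds 0. ((\<psi> \<circ> double_parabola) has_vector_derivative C1 s) (at s)"
    "\<forall>\<^sub>F s in nhds 0. (C1 has_vector_derivative C2 s) (at s)" "isCont C1 0" "isCont C2 0"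
    and C10: "C1 0 = (-2) *\<^sub>R frechet_derivative \<psi> (at 0) (axis 1 1)"
    using smooth_double_parabola_second_order[OF assms(1-3)] .
  have \<gamma>: "\<psi> \<circ> double_point_curve = (\<lambda>t. (\<psi> \<circ> double_parabola) (t^2))"
    by (auto simp: double_point_curve_parabola)
  have "\<forall>\<^sub>F t::real in at 0. t \<noteq> 0"
    by (simp add: eventually_at_filter)
  with square_curve_derivatives(1)[OF C(1,2)]
  have "\<forall>\<^sub>F t in at 0. vector_derivative (\<psi> \<circ> double_point_curve) (at t) = (2 * t) *\<^sub>R C1 (t^2)
      \<and> 2 * t \<noteq> 0"
    unfolding \<gamma> by eventually_elim simp
  moreover have "isCont (\<lambda>t. C1 (t^2)) 0"
    using C(3) by (intro isCont_o2[where g = C1 and f = "\<lambda>t. t^2"]) (auto intro!: continuous_intros)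
  then have "((\<lambda>t. C1 (t^2)) \<longlongrightarrow> C1 0) (at 0)"
    by (simp add: isCont_def)
  ultimately have "limiting_tangent_line (\<psi> \<circ> double_point_curve) L \<longleftrightarrow> L = span {C1 0}"
    using assms(4) C10 by (intro limiting_tangent_line_iff[where r = "\<lambda>t. 2 * t"]) auto
  also have "span {C1 0} = span {frechet_derivative \<psi> (at 0) (axis 1 1)}"
    unfolding C10 by (rule span_singleton_scaleR) simp
  finally show ?thesis .
qed

text \<open>The velocity of the singular curve is \<open>t\<close> times
  \<open>(-12, 24 * t, -12 * t^2)\<close>, so its limiting direction is the same axis as for the
  double point curve.\<close>

lemma limiting_tangent_line_singular_curve:
  assumes "smooth_on U \<psi>" "open U" "0 \<in> U" "frechet_derivative \<psi> (at 0) (axis 1 1) \<noteq> 0"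
  shows "limiting_tangent_line (\<psi> \<circ> singular_curve) L \<longleftrightarrow>
    L = span {frechet_derivative \<psi> (at 0) (axis 1 1)}"
proof -
  define E where "E v x = frechet_derivative \<psi> (at x) v" for v x
  define D where "D t = (-12) *\<^sub>R E (axis 1 1) (singular_curve t)
    + ((24 * t) *\<^sub>R E (axis 2 1) (singular_curve t) + (-12 * t^2) *\<^sub>R E (axis 3 1) (singular_curve t))" for t
  have sum: "singular_curve t
      = (-6 * t^2) *\<^sub>R axis 1 1 + ((8 * t^3) *\<^sub>R axis 2 1 + (-3 * t^4) *\<^sub>R axis 3 1)" for t
    by (simp add: singular_curve_def vector_3_eq_sum)
  have \<alpha>: "(singular_curve has_vector_derivative
      t *\<^sub>R ((-12) *\<^sub>R axis 1 1 + ((24 * t) *\<^sub>R axis 2 1 + (-12 * t^2) *\<^sub>R axis 3 1))) (at t)" for t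
    unfolding sum
    by (auto intro!: derivative_eq_intros simp: scaleR_add_right scaleR_diff_right power_numeral_reduce mult_ac)
  have \<alpha>0: "singular_curve 0 = 0"
    by (simp add: sum)
  have "isCont singular_curve 0"
    using \<alpha> has_vector_derivative_continuous by blast
  then have "(singular_curve \<longlongrightarrow> 0) (at 0)"
    by (simp add: isCont_def \<alpha>0)
  then have "\<forall>\<^sub>F t in at 0. singular_curve t \<in> U"
    using assms(2,3) by (rule topological_tendstoD)
  moreover have "\<forall>\<^sub>F t::real in at 0. t \<noteq> 0"
    by (simp add: eventually_at_filter)
  ultimately have "\<forall>\<^sub>F t in at 0. vector_derivative (\<psi> \<circ> singular_curve) (at t) = t *\<^sub>R D t \<and> t \<noteq> 0"
  proof eventually_elim
    case (elim t)
    have \<psi>: "(\<psi> has_derivative (\<lambda>v. E v (singular_curve t))) (at (singular_curve t))"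
      using smooth_on_differentiable[OF assms(1) elim(1)]
      by (simp add: E_def frechet_derivative_works)
    then have lin: "linear (\<lambda>v. E v (singular_curve t))"
      by (rule has_derivative_linear)
    have "((\<psi> \<circ> singular_curve) has_derivative (\<lambda>v. E v (singular_curve t)) \<circ> (\<lambda>x. x *\<^sub>R
        (t *\<^sub>R ((-12) *\<^sub>R axis 1 1 + ((24 * t) *\<^sub>R axis 2 1 + (-12 * t^2) *\<^sub>R axis 3 1))))) (at t)"
      using \<alpha>[of t] \<psi> unfolding has_vector_derivative_def by (rule diff_chain_at)
    then have "((\<psi> \<circ> singular_curve) has_vector_derivative t *\<^sub>R D t) (at t)"
      unfolding has_vector_derivative_def D_def o_def linear_scale[OF lin] linear_add[OF lin] .
    then show ?case
      using elim(2) by (simp add: vector_derivative_at)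
  qed
  moreover have "isCont D 0"
  proof -
    obtain G where G: "\<And>v x. x \<in> U \<Longrightarrow> (E v has_derivative G v x) (at x)"
      using smooth_on_second_order[OF assms(1)] unfolding E_def by metis
    have "isCont (E v) 0" for v
      using G[OF assms(3)] has_derivative_continuous by blast
    then have "isCont (\<lambda>t. E v (singular_curve t)) 0" for v
      using \<open>isCont singular_curve 0\<close>
      by (intro isCont_o2[where g = "E v" and f = singular_curve]) (simp_all add: \<alpha>0)
    then show ?thesis
      unfolding D_def by (intro continuous_intros)
  qed
  then have "(D \<longlongrightarrow> D 0) (at 0)"
    by (simp add: isCont_def)
  moreover have D0: "D 0 = (-12) *\<^sub>R frechet_derivative \<psi> (at 0) (axis 1 1)"
    by (simp add: D_def E_def \<alpha>0)
  ultimately have "limiting_tangent_line (\<psi> \<circ> singular_curve) L \<longleftrightarrow> L = span {D 0}"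
    using assms(4) by (intro limiting_tangent_line_iff[where r = "\<lambda>t. t"]) simp_all
  also have "span {D 0} = span {frechet_derivative \<psi> (at 0) (axis 1 1)}"
    unfolding D0 by (rule span_singleton_scaleR) simp
  finally show ?thesis .
qed

theorem proposition12:
  fixes \<psi> :: "real^3 \<Rightarrow> real^3" and \<nu> :: "real^3" and g :: "real^3 \<Rightarrow> real"
    and P :: "(real^3) set"
  assumes "diffeo_germ \<psi>"
    and "generic_swallowtail \<psi>"
    and "\<nu> \<in> sphere 0 1"
    and "g \<in> normal_forms"
    and "R_equivalent (height \<nu> \<circ> \<psi>) g"
    and "P = {p. height \<nu> p = 0}"
  shows
    "(g \<in> normal_form_u \<longrightarrow>
        transverse_to_swallowtail P \<psi> \<and>
        transverse_to_singular_curve P \<psi> \<and>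
        transverse_to_double_point_curve P \<psi>) \<and>
     (g \<in> normal_form_vu2 \<longrightarrow>
        transverse_to_swallowtail P \<psi> \<and>
        P \<in> limiting_tangent_pencil (\<psi> \<circ> double_point_curve) \<and>
        limiting_tangent_pencil (\<psi> \<circ> double_point_curve) =
          limiting_tangent_pencil (\<psi> \<circ> singular_curve)) \<and>
     (g \<in> normal_form_vu3 \<longrightarrow>
        transverse_to_swallowtail P \<psi> \<and>
        P \<in> limiting_tangent_pencil (\<psi> \<circ> singular_curve) \<and>
        limiting_osculating_plane (\<psi> \<circ> double_point_curve) P) \<and>
     (g \<in> normal_form_w \<longrightarrow> P = tangent_cone \<psi>)"
proof -

  \<comment> \<open>First and second order data of \<open>\<psi>\<close> at the origin\<close>
  obtain U V where \<psi>0: "\<psi> 0 = 0" and "0 \<in> U" and d: "diffeo_between U V \<psi>"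
    using assms(1) by (auto simp: diffeo_germ_def)
  have U: "open U" "0 \<in> U" and sm: "smooth_on U \<psi>"
    using d \<open>0 \<in> U\<close> by (auto simp: diffeo_between_def)
  define A where "A = frechet_derivative \<psi> (at 0)"
  have A: "(\<psi> has_derivative A) (at 0)"
    using smooth_on_differentiable[OF sm U(2)] by (simp add: A_def frechet_derivative_works)
  then have linA: "linear A"
    by (rule has_derivative_linear)
  obtain \<Psi> where \<Psi>: "(inv_into U \<psi> has_derivative \<Psi>) (at (\<psi> 0))" "\<Psi> \<circ> A = id" "A \<circ> \<Psi> = id"
    using diffeo_between_derivative[OF d U(2) A] .
  have lin\<Psi>: "linear \<Psi>"
    using \<Psi>(1) by (rule has_derivative_linear)
  have \<Psi>A: "\<Psi> (A x) = x" and A\<Psi>: "A (\<Psi> x) = x" for x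
    using \<Psi>(2,3) by (auto simp: fun_eq_iff)
  have A1: "A (axis 1 1) \<noteq> 0"
    using \<Psi>A[of "axis 1 1"] linear_0[OF lin\<Psi>] by auto
  obtain C1 C2 where
    C1: "\<forall>\<^sub>F s in nhds 0. ((\<psi> \<circ> double_parabola) has_vector_derivative C1 s) (at s)"
    and C2: "\<forall>\<^sub>F s in nhds 0. (C1 has_vector_derivative C2 s) (at s)"
    and cont: "isCont C1 0" "isCont C2 0" and C10: "C1 0 = (-2) *\<^sub>R A (axis 1 1)"
    using smooth_double_parabola_second_order[OF sm U, folded A_def] .
  have C20: "(C1 has_vector_derivative C2 0) (at 0)"
    using C2 by (rule eventually_nhds_x_imp_x)
  note height = R_equivalent_height[OF _ \<psi>0 A _ C1 C20]
  have \<nu>: "\<nu> \<noteq> 0"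
    using assms(3) by auto
  have lin_height: "linear (\<lambda>\<xi>. A \<xi> \<bullet> n)" for n
    using linA by (intro linearI) (simp_all add: linear_add linear_scale inner_add_left)

  have P: "P = {p. p \<bullet> \<nu> = 0}"
    using assms(6) by (simp add: height_def)
  have subP: "subspace P" and dimP: "dim P = 2"
    using \<nu> dim_hyperplane[OF \<nu>] unfolding P
    by (simp_all add: subspace_hyperplane2 inner_commute)

  \<comment> \<open>Pencils, transversality and independence of \<open>C1 0\<close> and
    \<open>C2 0\<close>\<close>
  have line: "limiting_tangent_line (\<psi> \<circ> double_point_curve) L \<longleftrightarrow> L = span {A (axis 1 1)}"
    "limiting_tangent_line (\<psi> \<circ> singular_curve) L \<longleftrightarrow> L = span {A (axis 1 1)}" for L
    using limiting_tangent_line_double_point_curve[OF sm U]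
      limiting_tangent_line_singular_curve[OF sm U] A1 unfolding A_def by blast+
  have in_pencil: "P \<in> limiting_tangent_pencil (\<psi> \<circ> double_point_curve)"
    "P \<in> limiting_tangent_pencil (\<psi> \<circ> singular_curve)" if "A (axis 1 1) \<bullet> \<nu> = 0"
  proof -
    have "span {A (axis 1 1)} \<subseteq> P"
      using that by (intro span_minimal subP) (simp add: P)
    then show "P \<in> limiting_tangent_pencil (\<psi> \<circ> double_point_curve)"
      "P \<in> limiting_tangent_pencil (\<psi> \<circ> singular_curve)"
      unfolding limiting_tangent_pencil_def line using subP dimP by auto
  qed

  have trans_cone: "transverse_to_swallowtail P \<psi>" if "A x \<bullet> \<nu> \<noteq> 0" "x$3 = 0" for x
    unfolding transverse_to_swallowtail_def tangent_cone_def assms(6) A_def[symmetric]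
  proof (rule transverse_hyperplane[OF that(1)])
    fix k
    show "k *\<^sub>R A x \<in> A ` {p. p$3 = 0}"
      using that(2) by (intro image_eqI[of _ _ "k *\<^sub>R x"]) (simp_all add: linear_scale[OF linA])
  qed

  \<comment> \<open>In the direction normal to the tangent cone, genericity excludes \<open>a = \<plusminus>1/4\<close>, so the height
    function has order exactly \<open>4\<close> along the double point curve.\<close>
  have indep: "C2 0 \<noteq> k *\<^sub>R C1 0" for k
  proof
    assume k: "C2 0 = k *\<^sub>R C1 0"
    \<comment> \<open>\<open>\<Psi>\<close> inverts \<open>A\<close>, so its adjoint sends the third
      axis to the normal of the tangent cone.\<close>
    define m where "m = adjoint \<Psi> (axis 3 1)"
    have m: "A \<xi> \<bullet> m = \<xi>$3" for \<xi>
      unfolding m_def adjoint_works[OF lin\<Psi>] by (simp add: \<Psi>A inner_axis)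
    have "m \<noteq> 0"
      using m[of "axis 3 1"] by (auto simp: axis_def)
    define n where "n = sgn m"
    have "n \<in> sphere 0 1"
      using \<open>m \<noteq> 0\<close> by (simp add: n_def norm_sgn)
    have n: "A \<xi> \<bullet> n = \<xi>$3 / norm m" for \<xi>
      by (simp add: n_def sgn_div_norm m divide_inverse_commute)
    obtain g' where "g' \<in> normal_form_u \<union> normal_form_vu2 \<union> normal_form_vu3 \<union> normal_form_w"
      and equiv: "R_equivalent (height n \<circ> \<psi>) g'"
      using assms(2) \<open>n \<in> sphere 0 1\<close> unfolding generic_swallowtail_def by fastforce
    have con: "conormal swallowtail 0 (\<lambda>\<xi>. A \<xi> \<bullet> n)"
      using lin_height[of n] by (simp add: conormal_swallowtail_0) (simp add: n axis_def)
    \<comment> \<open>The derivative of \<open>g'\<close> must be conormal at 0, that is, a multiple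
      of \<open>dw\<close>; this leaves only the fourth normal form.\<close>
    have not: "\<not> (g' has_derivative D) (at 0)" if "D (axis 1 1) \<noteq> 0 \<or> D (axis 2 1) \<noteq> 0" for D
    proof
      assume "(g' has_derivative D) (at 0)"
      then have "conormal swallowtail 0 D"
        using height(1)[OF equiv] con by blast
      then show False
        using that by (simp add: conormal_swallowtail_0)
    qed
    have "g' \<notin> normal_form_u"
      using normal_form_derivative(1)[of g'] not by (fastforce simp: axis_def)
    moreover have "g' \<notin> normal_form_vu2" "g' \<notin> normal_form_vu3"
      using normal_form_derivative(2,3)[of g'] not by (fastforce simp: axis_def)+
    ultimately have w: "g' \<in> normal_form_w"
      using \<open>g' \<in> _\<close> by blast
    then obtain s where "(g' has_derivative (\<lambda>\<xi>. s * \<xi>$3)) (at 0)"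
      using normal_form_derivative(4) by blast
    moreover have "C1 0 \<bullet> n = 0"
      by (simp add: C10 n axis_def)
    ultimately obtain c where "((\<lambda>s. g' (double_parabola s) / s^2) \<longlongrightarrow> c * (C2 0 \<bullet> n)) (at_right 0)"
      using height(3)[OF equiv] by blast
    \<comment> \<open>Dependence would make the second order limit 0, contrary to the fourth normal
      form.\<close>
    moreover have "C2 0 \<bullet> n = 0"
      using \<open>C1 0 \<bullet> n = 0\<close> by (simp add: k)
    ultimately show False
      using normal_form_double_parabola(2)[OF w]
      by (auto dest: tendsto_unique[OF trivial_limit_at_right_real])
  qed

  have v: "transverse_to_swallowtail P \<psi> \<and> A (axis 1 1) \<bullet> \<nu> = 0"
    if g: "(g has_derivative (\<lambda>\<xi>. \<xi>$2)) (at 0)"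
  proof -
    have A10: "A (axis 1 1) \<bullet> \<nu> = 0"
      using height(2)[OF assms(5) g] by (simp add: axis_def)
    have "\<not> conormal swallowtail 0 (\<lambda>\<xi>. \<xi>$2)"
      by (simp add: conormal_swallowtail_0 axis_def)
    \<comment> \<open>The functional kills the first axis but is not conormal, so it cannot kill the
      second, which lies over the tangent cone.\<close>
    then have "A (axis 2 1) \<bullet> \<nu> \<noteq> 0"
      using height(1)[OF assms(5) g] lin_height A10 by (simp add: conormal_swallowtail_0)
    then have "transverse_to_swallowtail P \<psi>"
      by (rule trans_cone) (simp add: axis_def)
    with A10 show ?thesis by blast
  qed

  \<comment> \<open>The four normal forms\<close>
  show ?thesis
  proof (intro conjI[of "_ \<longrightarrow> _"] impI)
    assume "g \<in> normal_form_u"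
    then obtain s where s: "s \<in> {1, -1}" and g: "(g has_derivative (\<lambda>\<xi>. s * \<xi>$1)) (at 0)"
      using normal_form_derivative(1) by blast
    \<comment> \<open>The image of the first axis spans the tangential line and lies in the tangent
      cone, so this one inequality gives all three transversalities.\<close>
    have A1\<nu>: "A (axis 1 1) \<bullet> \<nu> \<noteq> 0"
      using height(2)[OF assms(5) g] s by (auto simp: axis_def)
    have "transverse P (tangential_line \<psi>)"
      unfolding tangential_line_def assms(6) A_def[symmetric]
    proof (rule transverse_hyperplane[OF A1\<nu>])
      fix k
      show "k *\<^sub>R A (axis 1 1) \<in> A ` {p. p$2 = 0 \<and> p$3 = 0}"
        by (intro image_eqI[of _ _ "k *\<^sub>R axis 1 1"]) (simp_all add: linear_scale[OF linA] axis_def)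
    qed
    then show "transverse_to_swallowtail P \<psi> \<and> transverse_to_singular_curve P \<psi> \<and>
        transverse_to_double_point_curve P \<psi>"
      using trans_cone[OF A1\<nu>]
      by (simp add: transverse_to_singular_curve_def transverse_to_double_point_curve_def axis_def)
  next
    assume "g \<in> normal_form_vu2"
    from v[OF normal_form_derivative(2)[OF this]]
    show "transverse_to_swallowtail P \<psi> \<and>
        P \<in> limiting_tangent_pencil (\<psi> \<circ> double_point_curve) \<and>
        limiting_tangent_pencil (\<psi> \<circ> double_point_curve) =
          limiting_tangent_pencil (\<psi> \<circ> singular_curve)"
      using in_pencil by (simp add: limiting_tangent_pencil_def line)
  next
    assume vu3: "g \<in> normal_form_vu3"
    note g = normal_form_derivative(3)[OF vu3]
    have A1\<nu>: "A (axis 1 1) \<bullet> \<nu> = 0"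
      using v[OF g] by blast
    then have "C1 0 \<bullet> \<nu> = 0"
      by (simp add: C10)
    then obtain c where "0 < c"
      "((\<lambda>s. g (double_parabola s) / s^2) \<longlongrightarrow> c * (C2 0 \<bullet> \<nu>)) (at_right 0)"
      using height(3)[OF assms(5) g] by blast
    then have "C2 0 \<bullet> \<nu> = 0"
      using tendsto_unique[OF trivial_limit_at_right_real _ normal_form_double_parabola(1)[OF vu3]]
      by fastforce
    define N where "N = cross3 (C1 0) (C2 0)"
    have "N \<noteq> 0"
      unfolding N_def cross_eq_0 collinear_lemma using A1 C10 indep
      by (metis scaleR_eq_0_iff scaleR_zero_left zero_neq_neg_numeral)
    \<comment> \<open>\<open>P\<close> contains \<open>C1 0\<close> and \<open>C2 0\<close>, which
      span the limiting osculating plane; equal dimensions finish.\<close>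
    have "{p. p \<bullet> N = 0} = P"
    proof (rule subspace_dim_equal)
      show "{p. p \<bullet> N = 0} \<subseteq> P"
        unfolding span_pair_eq_hyperplane[OF \<open>N \<noteq> 0\<close>[unfolded N_def], folded N_def, symmetric]
        by (rule span_minimal[OF _ subP]) (simp add: P \<open>C1 0 \<bullet> \<nu> = 0\<close> \<open>C2 0 \<bullet> \<nu> = 0\<close>)
      show "dim P \<le> dim {p. p \<bullet> N = 0}"
        using dimP dim_hyperplane[OF \<open>N \<noteq> 0\<close>] by (simp add: inner_commute)
    qed (simp_all add: subspace_hyperplane2 subP)
    moreover have "limiting_osculating_plane (\<psi> \<circ> double_point_curve) {p. p \<bullet> N = 0}"
      using limiting_osculating_plane_square[OF C1 C2 cont] \<open>N \<noteq> 0\<close>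
      by (simp add: N_def o_def double_point_curve_parabola)
    ultimately show "transverse_to_swallowtail P \<psi> \<and>
        P \<in> limiting_tangent_pencil (\<psi> \<circ> singular_curve) \<and>
        limiting_osculating_plane (\<psi> \<circ> double_point_curve) P"
      using v[OF g] in_pencil by simp
  next
    assume "g \<in> normal_form_w"
    then obtain s where g: "(g has_derivative (\<lambda>\<xi>. s * \<xi>$3)) (at 0)"
      using normal_form_derivative(4) by blast
    have "linear (\<lambda>\<xi>::real^3. s * \<xi>$3)"
      using g by (rule has_derivative_linear)
    then have "conormal swallowtail 0 (\<lambda>\<xi>. s * \<xi>$3)"
      by (simp add: conormal_swallowtail_0 axis_def)
    then have "conormal swallowtail 0 (\<lambda>\<xi>. A \<xi> \<bullet> \<nu>)"
      using height(1)[OF assms(5) g] by blast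
    \<comment> \<open>The height differential is a multiple of the third coordinate; evaluating it
      at the preimage of \<open>\<nu>\<close> shows that the multiple is nonzero.\<close>
    then have A\<nu>: "A \<xi> \<bullet> \<nu> = \<xi>$3 * (A (axis 3 1) \<bullet> \<nu>)" for \<xi>
      using linear_axis_3[OF lin_height, of \<xi>] by (simp add: conormal_swallowtail_0)
    have A3: "A (axis 3 1) \<bullet> \<nu> \<noteq> 0"
      using A\<nu>[of "\<Psi> \<nu>"] \<nu> by (auto simp: A\<Psi>)
    have "p \<in> P \<longleftrightarrow> p \<in> tangent_cone \<psi>" for p
    proof
      assume "p \<in> P"
      then have "\<Psi> p $ 3 = 0"
        using A\<nu>[of "\<Psi> p"] A3 by (simp add: P A\<Psi>)
      then show "p \<in> tangent_cone \<psi>"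
        unfolding tangent_cone_def A_def[symmetric]
        by (intro image_eqI[of _ _ "\<Psi> p"]) (simp_all add: A\<Psi>)
    next
      assume "p \<in> tangent_cone \<psi>"
      then obtain x where x: "p = A x" "x$3 = 0"
        unfolding tangent_cone_def A_def[symmetric] by blast
      then show "p \<in> P"
        using A\<nu>[of x] by (simp add: P)
    qed
    then show "P = tangent_cone \<psi>"
      by blast
  qed
qed

end
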